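(* There is an algorithm which, given as input a simple planar graph $G$, computes the neighborhood polynomial $N(G,x)$ (i.e. all of its coefficients) in time polynomial in the size of $G$.
   Context: All graphs are simple, finite and undirected. For a graph $G=(V,E)$ and $v\in V$, $N_G(v)=\{u\in V: \{u,v\}\in E\}$ is the open neighborhood of $v$. The neighborhood complex of $G$ is $\mathcal N(G)=\{A\subseteq V : \exists v\in V,\ A\subseteq N_G(v)\}$, and the neighborhood polynomial of $G$ is $N(G,x)=\sum_{A\in\mathcal N(G)}x^{|A|}$. *)

theory Defs
  imports
    "HOL-Analysis.Analysis"
    "HOL-Computational_Algebra.Polynomial"
    "HOL-Library.Discrete_Functions"
begin

section \<open>Graphs and the neighborhood polynomial\<close>

definition simple_graph :: "'a set \<Rightarrow> 'a set set \<Rightarrow> bool" where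
  "simple_graph V E \<longleftrightarrow> finite V \<and> (\<forall>e\<in>E. e \<subseteq> V \<and> card e = 2)"

definition nbhd :: "'a set \<Rightarrow> 'a set set \<Rightarrow> 'a \<Rightarrow> 'a set" where
  "nbhd V E v = {u \<in> V. {u, v} \<in> E}"

definition nbhd_complex :: "'a set \<Rightarrow> 'a set set \<Rightarrow> 'a set set" where
  "nbhd_complex V E = {A. A \<subseteq> V \<and> (\<exists>v\<in>V. A \<subseteq> nbhd V E v)}"

definition nbhd_poly :: "'a set \<Rightarrow> 'a set set \<Rightarrow> nat poly" where
  "nbhd_poly V E = (\<Sum>A\<in>nbhd_complex V E. monom 1 (card A))"

text \<open>
  A drawing in the plane (identified with the complex numbers): vertices become distinct points,
  every edge becomes an arc joining its end points and avoiding all other vertices, and two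
  different edges meet only in their common end points.
\<close>

definition planar :: "'a set \<Rightarrow> 'a set set \<Rightarrow> bool" where
  "planar V E \<longleftrightarrow>
    (\<exists>(p :: 'a \<Rightarrow> complex) (\<gamma> :: 'a set \<Rightarrow> real \<Rightarrow> complex).
       inj_on p V \<and>
       (\<forall>e\<in>E. arc (\<gamma> e) \<and> {pathstart (\<gamma> e), pathfinish (\<gamma> e)} = p ` e \<and>
              path_image (\<gamma> e) \<inter> p ` V = p ` e) \<and>
       (\<forall>e\<in>E. \<forall>f\<in>E. e \<noteq> f \<longrightarrow> path_image (\<gamma> e) \<inter> path_image (\<gamma> f) = p ` (e \<inter> f)))"

section \<open>Random access machines with logarithmic cost\<close>

text \<open>
  This is the random access machine of Cook and Reckhow, over natural numbers (hence with truncated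
  subtraction), with a read-only input sequence and a write-only output sequence. There is no
  multiplication, and every instruction is charged the bit lengths of the numbers it
  handles, including those used as addresses. Under this cost measure polynomial time agrees with
  polynomial time on Turing machines. Numbers that occur in the instructions themselves are register
  indices and jump targets, except for the second argument of \<open>Const\<close>.
\<close>

datatype instr =
    Const nat nat      \<comment> \<open>\<open>X\<^sub>i := c\<close>\<close>
  | Add nat nat nat    \<comment> \<open>\<open>X\<^sub>i := X\<^sub>j + X\<^sub>k\<close>\<close>
  | Sub nat nat nat    \<comment> \<open>\<open>X\<^sub>i := X\<^sub>j - X\<^sub>k\<close>\<close>
  | Load nat nat       \<comment> \<open>\<open>X\<^sub>i := X\<^bsub>X\<^sub>j\<^esub>\<close>\<close>
  | Store nat nat      \<comment> \<open>\<open>X\<^bsub>X\<^sub>i\<^esub> := X\<^sub>j\<close>\<close>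
  | JumpPos nat nat    \<comment> \<open>\<open>if X\<^sub>j > 0 then goto m\<close>, arguments \<open>j m\<close>\<close>
  | Read nat           \<comment> \<open>\<open>X\<^sub>i :=\<close> next input number, or 0 if there is none\<close>
  | Print nat          \<comment> \<open>append \<open>X\<^sub>i\<close> to the output\<close>

record config =
  pc :: nat
  mem :: "nat \<Rightarrow> nat"
  inp :: "nat list"
  out :: "nat list"

definition input_head :: "config \<Rightarrow> nat" where
  "input_head s = (case inp s of [] \<Rightarrow> 0 | x # _ \<Rightarrow> x)"

definition put :: "nat \<Rightarrow> nat \<Rightarrow> config \<Rightarrow> config" where
  "put i x s = s\<lparr>pc := Suc (pc s), mem := (mem s)(i := x)\<rparr>"

fun exec :: "instr \<Rightarrow> config \<Rightarrow> config" where
  "exec (Const i c) s = put i c s"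
| "exec (Add i j k) s = put i (mem s j + mem s k) s"
| "exec (Sub i j k) s = put i (mem s j - mem s k) s"
| "exec (Load i j) s = put i (mem s (mem s j)) s"
| "exec (Store i j) s = put (mem s i) (mem s j) s"
| "exec (JumpPos j m) s = s\<lparr>pc := (if mem s j > 0 then m else Suc (pc s))\<rparr>"
| "exec (Read i) s = (put i (input_head s) s)\<lparr>inp := tl (inp s)\<rparr>"
| "exec (Print i) s = s\<lparr>pc := Suc (pc s), out := out s @ [mem s i]\<rparr>"

text \<open>The length of the binary representation of a number, where 0 has length 1.\<close>

definition bits :: "nat \<Rightarrow> nat" where
  "bits n = Suc (floor_log n)"

fun cost :: "instr \<Rightarrow> config \<Rightarrow> nat" where
  "cost (Const i c) s = bits c"
| "cost (Add i j k) s = bits (mem s j) + bits (mem s k)"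
| "cost (Sub i j k) s = bits (mem s j) + bits (mem s k)"
| "cost (Load i j) s = bits (mem s j) + bits (mem s (mem s j))"
| "cost (Store i j) s = bits (mem s i) + bits (mem s j)"
| "cost (JumpPos j m) s = bits (mem s j)"
| "cost (Read i) s = bits (input_head s)"
| "cost (Print i) s = bits (mem s i)"

text \<open>
  \<open>run P s t s'\<close>: started in \<open>s\<close>, the program \<open>P\<close> halts in \<open>s'\<close> after instructions of total cost
  \<open>t\<close>. A program halts when the program counter leaves it.
\<close>

inductive run :: "instr list \<Rightarrow> config \<Rightarrow> nat \<Rightarrow> config \<Rightarrow> bool" for P where
  halt: "pc s \<ge> length P \<Longrightarrow> run P s 0 s"
| step: "pc s < length P \<Longrightarrow> run P (exec (P ! pc s) s) t s' \<Longrightarrow> run P s (cost (P ! pc s) s + t) s'"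

definition computes_in_time :: "instr list \<Rightarrow> nat list \<Rightarrow> nat list \<Rightarrow> nat \<Rightarrow> bool" where
  "computes_in_time P xs ys t \<longleftrightarrow>
    (\<exists>s. run P \<lparr>pc = 0, mem = (\<lambda>_. 0), inp = xs, out = []\<rparr> t s \<and> out s = ys)"

section \<open>Graphs as inputs\<close>

text \<open>
  The number of vertices followed by the adjacency matrix, row by row, with respect to an
  enumeration \<open>vs\<close> of the vertices.
\<close>

definition encode_graph :: "'a list \<Rightarrow> 'a set set \<Rightarrow> nat list" where
  "encode_graph vs E = length vs # [if {u, v} \<in> E then 1 else 0. u \<leftarrow> vs, v \<leftarrow> vs]"

end

theory Submission
  imports Defs
begin

text \<open>
  A planar graph contains no \<open>K\<^bsub>3,3\<^esub>\<close>: the paths between two vertices of one side through the three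
  vertices of the other side form a theta curve, and no complementary region of a theta curve has all
  three open arcs on its boundary. Hence at most two neighborhoods contain a given set of at least three
  vertices, and for \<open>k \<ge> 3\<close> inclusion-exclusion gives the number of faces of size \<open>k\<close> as
  \<open>(\<Sum>v. deg v choose k) - (\<Sum>u<v. codeg u v choose k)\<close>. The faces of size at most 2 are counted directly.
  These numbers are computed by additions only from the histograms of the degrees and codegrees.

  The machine code is obtained from a loop language in which the number of steps is evidently polynomial.
  Since the machine has no multiplication, numbers at most double in each step, so a polynomial number
  of steps has polynomial logarithmic cost.
\<close>

section \<open>Theta curves and the complete bipartite graph on 3 + 3 vertices\<close>

text \<open>A star with n leaves already has at least \<open>2^n\<close> faces, so the faces cannot
  be listed and have to be counted by size. Counting a face once for every neighborhood
  \<open>W\<close> that contains it overcounts; when one or two neighborhoods contain it, the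
  identity \<open>1 + (card W choose 2) = card W\<close> (with \<open>W\<close> the set of these
  neighborhoods) corrects this exactly. All the binomial sums come at once as the coefficients of
  \<Sum>d \<open>h d (1 + X)^d\<close>, where \<open>h\<close> is a histogram of exponents. Horner's
  scheme in \<open>1 + X\<close> needs only shifts and additions, which suits a machine without
  multiplication. The output must be the coefficient list without trailing zeros. The complex is
  closed under subsets, so the nonzero coefficients form an initial segment and it is enough to
  count them. For K33, two vertices of one side are the ends of the theta curve and the third one,
  with its three edges, is a tripod that would have to touch all three arcs from within one
  face.\<close>

definition theta :: "complex \<Rightarrow> complex \<Rightarrow> (real \<Rightarrow> complex) \<Rightarrow> (real \<Rightarrow> complex) \<Rightarrow> (real \<Rightarrow> complex) \<Rightarrow> bool" where
  "theta x y c1 c2 c3 \<longleftrightarrow> x \<noteq> y \<and>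
     (\<forall>c\<in>{c1, c2, c3}. arc c \<and> pathstart c = x \<and> pathfinish c = y) \<and>
     path_image c1 \<inter> path_image c2 = {x, y} \<and>
     path_image c1 \<inter> path_image c3 = {x, y} \<and>
     path_image c2 \<inter> path_image c3 = {x, y}"

lemma theta_rotate: "theta x y c1 c2 c3 \<Longrightarrow> theta x y c2 c3 c1"
  by (auto simp: theta_def)

lemma connected_inside:
  assumes "connected D" "D \<inter> S = {}" "u \<in> D" "v \<in> D" "u \<in> inside S"
  shows "v \<in> inside S"
proof -
  have "connected_component (- S) u v"
    using assms by (auto simp: connected_component_def)
  then show ?thesis
    using assms(5) inside_same_component by blast
qed

text \<open>Following one arc and returning along the other is a simple closed curve, so the Jordan
  curve theorem applies.\<close>

lemma two_arcs_Jordan: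
  fixes g h :: "real \<Rightarrow> complex"
  assumes "arc g" "arc h" "pathstart g = x" "pathfinish g = y" "pathstart h = x" "pathfinish h = y"
    and "path_image g \<inter> path_image h = {x, y}"
  shows "inside (path_image g \<union> path_image h) \<noteq> {}"
    and "connected (inside (path_image g \<union> path_image h))"
    and "connected (outside (path_image g \<union> path_image h))"
    and "frontier (inside (path_image g \<union> path_image h)) = path_image g \<union> path_image h"
proof -
  have "simple_path (g +++ reversepath h)"
    using assms by (intro simple_path_join_loop) (auto simp: arc_reversepath)
  moreover have "pathfinish (g +++ reversepath h) = pathstart (g +++ reversepath h)"
    using assms by simp
  moreover have "path_image (g +++ reversepath h) = path_image g \<union> path_image h"
    using assms by (simp add: path_image_join)
  ultimately show "inside (path_image g \<union> path_image h) \<noteq> {}"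
    "connected (inside (path_image g \<union> path_image h))"
    "connected (outside (path_image g \<union> path_image h))"
    "frontier (inside (path_image g \<union> path_image h)) = path_image g \<union> path_image h"
    using Jordan_inside_outside[of "g +++ reversepath h"] by auto
qed

text \<open>The sets \<open>D1\<close>, \<open>D2\<close>, \<open>D3\<close> form a tripod that
  joins \<open>z\<close> to one point of each open arc and meets the theta curve nowhere else. If
  the third arc ran inside the other two, it would cut that inside into two regions. The leg
  \<open>D3\<close> puts \<open>z\<close> inside, hence into one of the regions, and the leg to the
  arc that does not bound this region carries a point of that arc into the inside of a curve on
  which it lies.\<close>

lemma theta_arc_not_inside:
  assumes th: "theta x y c1 c2 c3"
    and a: "a1 \<in> path_image c1 - {x, y}" "a2 \<in> path_image c2 - {x, y}" "a3 \<in> path_image c3 - {x, y}"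
    and D: "connected D1" "z \<in> D1" "D1 \<inter> T = {a1}"
      "connected D2" "z \<in> D2" "D2 \<inter> T = {a2}"
      "connected D3" "z \<in> D3" "D3 \<inter> T = {a3}"
    and z: "z \<notin> T"
    and T: "T = path_image c1 \<union> path_image c2 \<union> path_image c3"
  shows "a3 \<notin> inside (path_image c1 \<union> path_image c2)"
proof
  let ?C1 = "path_image c1" and ?C2 = "path_image c2" and ?C3 = "path_image c3"
  assume ins: "a3 \<in> inside (?C1 \<union> ?C2)"
  have int: "?C1 \<inter> ?C2 = {x, y}" "?C1 \<inter> ?C3 = {x, y}" "?C2 \<inter> ?C3 = {x, y}"
    using th by (auto simp: theta_def)
  have arcs: "arc c1" "arc c2" "arc c3"
    and ends: "pathstart c1 = x" "pathstart c2 = x" "pathstart c3 = x"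
      "pathfinish c1 = y" "pathfinish c2 = y" "pathfinish c3 = y" and "x \<noteq> y"
    using th by (auto simp: theta_def)
  have "?C3 \<inter> inside (?C1 \<union> ?C2) \<noteq> {}"
    using ins a(3) by blast
  then have split: "inside (?C1 \<union> ?C3) \<union> inside (?C2 \<union> ?C3) \<union> (?C3 - {x, y}) = inside (?C1 \<union> ?C2)"
    using split_inside_simple_closed_curve[OF arc_imp_simple_path[OF arcs(1)] ends(1,4)
        arc_imp_simple_path[OF arcs(2)] ends(2,5) arc_imp_simple_path[OF arcs(3)] ends(3,6) \<open>x \<noteq> y\<close> int]
    by metis
  have notin: "a1 \<notin> ?C2" "a1 \<notin> ?C3" "a2 \<notin> ?C1" "a2 \<notin> ?C3" "a3 \<notin> ?C1" "a3 \<notin> ?C2"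
    using a int by (metis DiffE IntI)+
  have meet_disjoint: "D \<inter> S = {}" "a \<in> D" if "D \<inter> T = {a}" "S \<subseteq> T" "a \<notin> S" for D S :: "complex set" and a
    using that by auto
  have "D3 \<inter> (?C1 \<union> ?C2) = {}"
    using notin by (intro meet_disjoint[OF D(9)]) (auto simp: T)
  moreover have "a3 \<in> D3"
    using D(9) by auto
  ultimately have "z \<in> inside (?C1 \<union> ?C2)"
    using connected_inside D(7,8) ins by metis
  then consider "z \<in> inside (?C1 \<union> ?C3)" | "z \<in> inside (?C2 \<union> ?C3)"
    using z split T by (metis DiffE UnE UnI1 UnI2)
  then show False
  proof cases
    case 1
    have "D2 \<inter> (?C1 \<union> ?C3) = {}"
      using notin by (intro meet_disjoint[OF D(6)]; auto simp: T)+
    then have "a2 \<in> inside (?C1 \<union> ?C3)"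
      using connected_inside D(4,5,6) 1 by (metis IntE singletonI)
    then have "a2 \<in> inside (?C1 \<union> ?C2)"
      using split by auto
    then show False
      using a(2) inside_no_overlap by blast
  next
    case 2
    have "D1 \<inter> (?C2 \<union> ?C3) = {}"
      using notin by (intro meet_disjoint[OF D(3)]; auto simp: T)+
    then have "a1 \<in> inside (?C2 \<union> ?C3)"
      using connected_inside D(1,2,3) 2 by (metis IntE singletonI)
    then have "a1 \<in> inside (?C1 \<union> ?C2)"
      using split by auto
    then show False
      using a(1) inside_no_overlap by blast
  qed
qed

text \<open>
  If no open arc lies inside the curve of the other two, then a point inside the curve of the first
  two arcs is outside the other two curves, whose intersection is the third arc. By Janiszewski's
  theorem that point is then connected to infinity in the complement of all three arcs.
\<close>

lemma theta_some_arc_inside: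
  assumes th: "theta x y c1 c2 c3"
    and a: "a1 \<in> path_image c1 - {x, y}" "a2 \<in> path_image c2 - {x, y}" "a3 \<in> path_image c3 - {x, y}"
    and out: "a1 \<notin> inside (path_image c2 \<union> path_image c3)"
      "a2 \<notin> inside (path_image c1 \<union> path_image c3)"
      "a3 \<notin> inside (path_image c1 \<union> path_image c2)"
  shows False
proof -
  let ?C1 = "path_image c1" and ?C2 = "path_image c2" and ?C3 = "path_image c3"
  have int: "?C1 \<inter> ?C2 = {x, y}" "?C1 \<inter> ?C3 = {x, y}" "?C2 \<inter> ?C3 = {x, y}"
    using th by (auto simp: theta_def)
  have arcs: "arc c1" "arc c2" "arc c3"
    and ends: "pathstart c1 = x" "pathstart c2 = x" "pathstart c3 = x"
      "pathfinish c1 = y" "pathfinish c2 = y" "pathfinish c3 = y"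
    using th by (auto simp: theta_def)
  note J12 = two_arcs_Jordan[OF arcs(1,2) ends(1,4,2,5) int(1)]
  note J13 = two_arcs_Jordan[OF arcs(1,3) ends(1,4,3,6) int(2)]
  note J23 = two_arcs_Jordan[OF arcs(2,3) ends(2,5,3,6) int(3)]
  have comp: "compact (?C1 \<union> ?C2 \<union> ?C3)"
    using arcs by (simp add: compact_Un compact_arc_image)
  \<comment> \<open>The open arc is connected and disjoint from the other two arcs, so the single
    point \<open>a3\<close> decides for the whole of it.\<close>
  have "connected (?C3 - {x, y})"
    using connected_simple_path_endless[of c3] arcs ends by (simp add: arc_imp_simple_path)
  then have "v \<notin> inside (?C1 \<union> ?C2)" if "v \<in> ?C3 - {x, y}" for v
    using connected_inside[of "?C3 - {x, y}" "?C1 \<union> ?C2" v a3] that a(3) out(3) int by blast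
  moreover have "{x, y} \<subseteq> ?C1"
    using int by auto
  ultimately have dis: "inside (?C1 \<union> ?C2) \<inter> (?C1 \<union> ?C2 \<union> ?C3) = {}"
    using inside_no_overlap[of "?C1 \<union> ?C2"] by blast
  obtain p where p: "p \<in> inside (?C1 \<union> ?C2)"
    using J12(1) by auto
  have cl: "closure (inside S) \<subseteq> inside S \<union> S" if "frontier (inside S) = S" for S :: "complex set"
    using that by (simp add: closure_Un_frontier)
  \<comment> \<open>Otherwise the inside of the first two arcs, being connected and free of
    \<open>?C3\<close>, would lie in this region entirely. Its frontier point \<open>a1\<close>
    would then be in the closure of the region, although \<open>a1\<close> is neither inside nor on
    the two arcs. The same argument with \<open>a2\<close> follows below.\<close>
  have "p \<notin> inside (?C2 \<union> ?C3)"
  proof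
    assume "p \<in> inside (?C2 \<union> ?C3)"
    then have "inside (?C1 \<union> ?C2) \<subseteq> inside (?C2 \<union> ?C3)"
      using connected_inside[OF J12(2) _ p, of "?C2 \<union> ?C3"] dis by blast
    then have "closure (inside (?C1 \<union> ?C2)) \<subseteq> inside (?C2 \<union> ?C3) \<union> (?C2 \<union> ?C3)"
      using closure_mono cl[OF J23(4)] by blast
    moreover have "a1 \<in> closure (inside (?C1 \<union> ?C2))"
      using J12(4) a(1) by (auto simp: closure_Un_frontier)
    ultimately show False
      using out(1) a(1) int by auto
  qed
  then have p23: "p \<in> outside (?C2 \<union> ?C3)"
    using dis p outside_inside by blast
  have "p \<notin> inside (?C1 \<union> ?C3)"
  proof
    assume "p \<in> inside (?C1 \<union> ?C3)"
    then have "inside (?C1 \<union> ?C2) \<subseteq> inside (?C1 \<union> ?C3)"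
      using connected_inside[OF J12(2) _ p, of "?C1 \<union> ?C3"] dis by blast
    then have "closure (inside (?C1 \<union> ?C2)) \<subseteq> inside (?C1 \<union> ?C3) \<union> (?C1 \<union> ?C3)"
      using closure_mono cl[OF J13(4)] by blast
    moreover have "a2 \<in> closure (inside (?C1 \<union> ?C2))"
      using J12(4) a(2) by (auto simp: closure_Un_frontier)
    ultimately show False
      using out(2) a(2) int by auto
  qed
  then have p13: "p \<in> outside (?C1 \<union> ?C3)"
    using dis p outside_inside by blast
  \<comment> \<open>The point \<open>w\<close> stands for infinity: it is outside all three arcs
    together, hence outside each pair.\<close>
  obtain w where w: "w \<in> outside (?C1 \<union> ?C2 \<union> ?C3)"
    using outside_bounded_nonempty[of "?C1 \<union> ?C2 \<union> ?C3"] compact_imp_bounded[OF comp] by blast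
  have "connected_component (- (?C2 \<union> ?C3)) p w"
    using J23(3) p23 w outside_mono[of "?C2 \<union> ?C3" "?C1 \<union> ?C2 \<union> ?C3"]
    by (auto simp: connected_component_def intro!: exI[of _ "outside (?C2 \<union> ?C3)"])
       (metis Un_iff disjoint_iff outside_no_overlap)+
  moreover have "connected_component (- (?C1 \<union> ?C3)) p w"
    using J13(3) p13 w outside_mono[of "?C1 \<union> ?C3" "?C1 \<union> ?C2 \<union> ?C3"]
    by (auto simp: connected_component_def intro!: exI[of _ "outside (?C1 \<union> ?C3)"])
       (metis Un_iff disjoint_iff outside_no_overlap)+
  moreover have "(?C2 \<union> ?C3) \<inter> (?C1 \<union> ?C3) = ?C3"
    using int by auto
  ultimately have "connected_component (- ((?C2 \<union> ?C3) \<union> (?C1 \<union> ?C3))) p w"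
    using arcs by (intro Janiszewski[of "?C2 \<union> ?C3" "?C1 \<union> ?C3"])
      (simp_all only: compact_Un closed_Un compact_arc_image closed_arc_image connected_arc_image)
  moreover have "(?C2 \<union> ?C3) \<union> (?C1 \<union> ?C3) = ?C1 \<union> ?C2 \<union> ?C3"
    by auto
  ultimately have "connected_component (- (?C1 \<union> ?C2 \<union> ?C3)) w p"
    using connected_component_sym by metis
  then have "p \<in> outside (?C1 \<union> ?C2 \<union> ?C3)"
    using outside_same_component w by blast
  then have "p \<in> outside (?C1 \<union> ?C2)"
    using outside_mono[of "?C1 \<union> ?C2" "?C1 \<union> ?C2 \<union> ?C3"] by auto
  then show False
    using p inside_Int_outside by blast
qed

text \<open>By symmetry the tripod keeps each arc from being inside the curve of the other two, but
  some arc has to be there.\<close>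

lemma theta_no_common_face:
  assumes th: "theta x y c1 c2 c3"
    and a: "a1 \<in> path_image c1 - {x, y}" "a2 \<in> path_image c2 - {x, y}" "a3 \<in> path_image c3 - {x, y}"
    and D: "connected D1" "z \<in> D1" "D1 \<inter> T = {a1}"
      "connected D2" "z \<in> D2" "D2 \<inter> T = {a2}"
      "connected D3" "z \<in> D3" "D3 \<inter> T = {a3}"
    and z: "z \<notin> T"
    and T: "T = path_image c1 \<union> path_image c2 \<union> path_image c3"
  shows False
proof -
  have T': "T = path_image c2 \<union> path_image c3 \<union> path_image c1"
    "T = path_image c3 \<union> path_image c1 \<union> path_image c2"
    unfolding T by blast+
  have "a3 \<notin> inside (path_image c1 \<union> path_image c2)"
    by (rule theta_arc_not_inside[OF th a D z T])
  moreover have "a1 \<notin> inside (path_image c2 \<union> path_image c3)"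
    by (rule theta_arc_not_inside[OF theta_rotate[OF th] a(2,3,1) D(4-9,1-3) z T'(1)])
  moreover have "a2 \<notin> inside (path_image c1 \<union> path_image c3)"
    unfolding Un_commute[of "path_image c1"]
    by (rule theta_arc_not_inside[OF theta_rotate[OF theta_rotate[OF th]] a(3,1,2) D(7-9,1-6) z T'(2)])
  ultimately show False
    using theta_some_arc_inside[OF th a] by blast
qed

text \<open>The theta curve has the ends \<open>p b1\<close> and \<open>p b2\<close>, and its arc
  \<open>c a\<close> runs through \<open>p a\<close>. The drawn edges from \<open>b3\<close> are the
  legs of the tripod.\<close>

lemma planar_no_K33:
  assumes simple: "simple_graph V E" and planar: "planar V E"
    and a: "a1 \<noteq> a2" "a1 \<noteq> a3" "a2 \<noteq> a3" and b: "b1 \<noteq> b2" "b1 \<noteq> b3" "b2 \<noteq> b3"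
    and edges: "\<And>a b. a \<in> {a1, a2, a3} \<Longrightarrow> b \<in> {b1, b2, b3} \<Longrightarrow> {a, b} \<in> E"
  shows False
proof -
  let ?A = "{a1, a2, a3}" and ?B = "{b1, b2, b3}"
  obtain p :: "'a \<Rightarrow> complex" and \<gamma> where inj: "inj_on p V"
    and drawing: "\<forall>e\<in>E. arc (\<gamma> e) \<and> {pathstart (\<gamma> e), pathfinish (\<gamma> e)} = p ` e \<and>
      path_image (\<gamma> e) \<inter> p ` V = p ` e"
    and meet: "\<forall>e\<in>E. \<forall>f\<in>E. e \<noteq> f \<longrightarrow> path_image (\<gamma> e) \<inter> path_image (\<gamma> f) = p ` (e \<inter> f)"
    using planar unfolding planar_def by (elim exE conjE)
  have arc: "arc (\<gamma> e)" and ends: "{pathstart (\<gamma> e), pathfinish (\<gamma> e)} = p ` e" if "e \<in> E" for e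
    using drawing that by auto
  \<comment> \<open>Disjointness of the two sides is not assumed; it follows because an edge has
    exactly two elements.\<close>
  have ab: "a \<noteq> b \<and> a \<in> V \<and> b \<in> V" if "a \<in> ?A" "b \<in> ?B" for a b
  proof -
    have "{a, b} \<subseteq> V" "card {a, b} = 2"
      using simple edges[OF that] by (auto simp only: simple_graph_def)
    then show ?thesis
      by (cases "a = b") auto
  qed
  have p_eq: "p u = p v \<longleftrightarrow> u = v" if "u \<in> ?A \<union> ?B" "v \<in> ?A \<union> ?B" for u v
    using that inj_onD[OF inj] ab by blast
  \<comment> \<open>A drawing fixes only the set of end points of an edge, so the edge curve is
    oriented here to start at the \<open>b\<close> end.\<close>
  define g where "g b a = (if pathstart (\<gamma> {a, b}) = p b then \<gamma> {a, b} else reversepath (\<gamma> {a, b}))" for a b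
  have g: "arc (g b a) \<and> pathstart (g b a) = p b \<and> pathfinish (g b a) = p a \<and>
      path_image (g b a) = path_image (\<gamma> {a, b})" if "a \<in> ?A" "b \<in> ?B" for a b
    using ends[OF edges[OF that]] arc[OF edges[OF that]] ab[OF that] p_eq[of a b] that
    by (auto simp: g_def arc_reversepath doubleton_eq_iff)
  have image: "p a \<in> path_image (g b a)" "p b \<in> path_image (g b a)" if "a \<in> ?A" "b \<in> ?B" for a b
    using g[OF that] pathstart_in_path_image pathfinish_in_path_image by metis+
  have cross: "path_image (g b a) \<inter> path_image (g b' a') = p ` ({a, b} \<inter> {a', b'})"
    if "a \<in> ?A" "b \<in> ?B" "a' \<in> ?A" "b' \<in> ?B" "a \<noteq> a' \<or> b \<noteq> b'" for a b a' b'
    using meet edges[OF that(1,2)] edges[OF that(3,4)] g that ab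
    by (metis doubleton_eq_iff)
  define c where "c a = g b1 a +++ reversepath (g b2 a)" for a
  have c_image: "path_image (c a) = path_image (g b1 a) \<union> path_image (g b2 a)" if "a \<in> ?A" for a
    using g[OF that, of b1] g[OF that, of b2] by (simp add: c_def path_image_join)
  have c_arc: "arc (c a) \<and> pathstart (c a) = p b1 \<and> pathfinish (c a) = p b2" if "a \<in> ?A" for a
  proof -
    have "{a, b1} \<inter> {a, b2} = {a}"
      using b by auto
    then have "path_image (g b1 a) \<inter> path_image (g b2 a) = {p a}"
      using cross[of a b1 a b2] that b by simp
    then show ?thesis
      using g[OF that, of b1] g[OF that, of b2]
      by (simp add: c_def arc_join arc_reversepath)
  qed
  have c_meet: "path_image (c a) \<inter> path_image (c a') = {p b1, p b2}"
    if "a \<in> ?A" "a' \<in> ?A" "a \<noteq> a'" for a a'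
  proof -
    have "{a, b1} \<inter> {a', b1} = {b1}" "{a, b1} \<inter> {a', b2} = {}"
      "{a, b2} \<inter> {a', b1} = {}" "{a, b2} \<inter> {a', b2} = {b2}"
      using that ab b by blast+
    then have "path_image (g b1 a) \<inter> path_image (g b1 a') = {p b1}"
      "path_image (g b1 a) \<inter> path_image (g b2 a') = {}"
      "path_image (g b2 a) \<inter> path_image (g b1 a') = {}"
      "path_image (g b2 a) \<inter> path_image (g b2 a') = {p b2}"
      using cross[of a _ a'] that by simp_all
    then show ?thesis
      using that by (auto simp: c_image)
  qed
  have D_meet: "path_image (g b3 a) \<inter> (path_image (c a1) \<union> path_image (c a2) \<union> path_image (c a3)) = {p a}"
    if "a \<in> ?A" for a
  proof -
    have edge_meet: "path_image (g b3 a) \<inter> path_image (g b' a') = (if a = a' then {p a} else {})"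
      if "a' \<in> ?A" "b' \<in> {b1, b2}" for a' b'
    proof -
      have "b' \<in> ?B" "b' \<noteq> b3"
        using that b by blast+
      then have "a \<noteq> b'" "a' \<noteq> b3"
        using ab \<open>a \<in> ?A\<close> that(1) by (blast, metis insertCI)
      then have "{a, b3} \<inter> {a', b'} = (if a = a' then {a} else {})"
        using \<open>b' \<noteq> b3\<close> by auto
      moreover have "path_image (g b3 a) \<inter> path_image (g b' a') = p ` ({a, b3} \<inter> {a', b'})"
        using \<open>b' \<noteq> b3\<close> by (intro cross[OF \<open>a \<in> ?A\<close> _ that(1) \<open>b' \<in> ?B\<close>]) simp_all
      ultimately show ?thesis
        by simp
    qed
    have "path_image (g b3 a) \<inter> path_image (c a') = (if a = a' then {p a} else {})"
      if "a' \<in> ?A" for a'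
      using edge_meet[OF that, of b1] edge_meet[OF that, of b2] by (simp add: c_image[OF that] Int_Un_distrib)
    from this[of a1] this[of a2] this[of a3] show ?thesis
      unfolding Int_Un_distrib using that by (simp split: if_splits)
  qed
  have b3: "p b3 \<notin> path_image (c a1) \<union> path_image (c a2) \<union> path_image (c a3)"
  proof
    assume "p b3 \<in> path_image (c a1) \<union> path_image (c a2) \<union> path_image (c a3)"
    then have "p b3 = p a1"
      using D_meet[of a1] image(2)[of a1 b3] by blast
    then show False
      using p_eq[of a1 b3] ab[of a1 b3] by simp
  qed
  have "p b1 \<noteq> p b2"
    using p_eq[of b1 b2] b by simp
  then have th: "theta (p b1) (p b2) (c a1) (c a2) (c a3)"
    unfolding theta_def using c_arc c_meet a by simp
  have on: "p a \<in> path_image (c a) - {p b1, p b2}" if "a \<in> ?A" for a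
  proof -
    have "p a \<noteq> p b1" "p a \<noteq> p b2"
      using p_eq[of a b1] p_eq[of a b2] ab[OF that, of b1] ab[OF that, of b2] that by simp_all
    then show ?thesis
      using c_image[OF that] image(1)[OF that, of b1] by simp
  qed
  have conn: "connected (path_image (g b3 a))" if "a \<in> ?A" for a
    using g[OF that, of b3] connected_arc_image by blast
  have mem: "a1 \<in> ?A" "a2 \<in> ?A" "a3 \<in> ?A" "b3 \<in> ?B"
    by simp_all
  show False
    using theta_no_common_face[OF th on[OF mem(1)] on[OF mem(2)] on[OF mem(3)]
        conn[OF mem(1)] image(2)[OF mem(1,4)] D_meet[OF mem(1)]
        conn[OF mem(2)] image(2)[OF mem(2,4)] D_meet[OF mem(2)]
        conn[OF mem(3)] image(2)[OF mem(3,4)] D_meet[OF mem(3)] b3 refl] .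
qed

section \<open>Counting faces of the neighborhood complex\<close>

text \<open>This is \<open>1 + (m choose 2) = m\<close> for \<open>m\<close> equal to 1 or 2:
  inclusion-exclusion cut off after pairs. The condition \<open>j < i\<close> counts each pair
  once.\<close>

lemma pairs_in_small_set:
  fixes W :: "nat set"
  assumes W: "W \<subseteq> {..<n}" and "W \<noteq> {}" and "card W \<le> 2"
  shows "1 + (\<Sum>i<n. \<Sum>j<n. if j < i then of_bool (i \<in> W \<and> j \<in> W) else 0) = card W"
proof -
  have "finite W"
    using W finite_subset by blast
  then have "card W \<noteq> 0"
    using \<open>W \<noteq> {}\<close> by simp
  with \<open>card W \<le> 2\<close> consider "card W = 1" | "card W = 2"
    by linarith
  then show ?thesis
  proof cases
    case 1
    then obtain a where "W = {a}"
      by (auto simp: card_1_singleton_iff)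
    then have "(\<Sum>i<n. \<Sum>j<n. if j < i then of_bool (i \<in> W \<and> j \<in> W) else 0) = (0 :: nat)"
      by (auto intro!: sum.neutral)
    with 1 show ?thesis
      by simp
  next
    case 2
    then obtain a b where ab: "W = {a, b}" "a < b"
      by (metis card_2_iff doubleton_eq_iff nat_neq_iff)
    have "(\<Sum>i<n. \<Sum>j<n. if j < i then of_bool (i \<in> W \<and> j \<in> W) else 0) =
        (\<Sum>i<n. \<Sum>j<n. if i = b then if j = a then 1 else 0 else (0 :: nat))"
      using ab by (intro sum.cong refl) auto
    also have "\<dots> = 1"
      using ab W by (simp add: if_distrib[of "sum _"] sum.If_cases Int_absorb1 cong: if_cong)
    finally show ?thesis
      using 2 by simp
  qed
qed

text \<open>Double counting of the incidences \<open>A \<subseteq> N i\<close>. Each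
  \<open>A\<close> contributes the size of \<open>?W A\<close>, which is one plus the number of
  pairs in it. Summing those pairs over \<open>A\<close> gives the binomials of the
  intersections.\<close>

lemma sum_choose_overlaps:
  fixes N :: "nat \<Rightarrow> 'a set"
  assumes fin: "\<And>i. i < n \<Longrightarrow> finite (N i)"
    and triple: "\<And>A. card A = k \<Longrightarrow> card {i. i < n \<and> A \<subseteq> N i} \<le> 2"
  shows "card {A. card A = k \<and> (\<exists>i<n. A \<subseteq> N i)} +
      (\<Sum>i<n. \<Sum>j<n. if j < i then card (N i \<inter> N j) choose k else 0) = (\<Sum>i<n. card (N i) choose k)"
proof -
  let ?X = "{A. card A = k \<and> (\<exists>i<n. A \<subseteq> N i)}" and ?W = "\<lambda>A. {i. i < n \<and> A \<subseteq> N i}"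
  have finX: "finite ?X"
    by (rule finite_subset[of _ "\<Union>i<n. Pow (N i)"]) (use fin in auto)
  have choose: "card B choose k = (\<Sum>A\<in>?X. of_bool (A \<subseteq> B))" if "i < n" "B \<subseteq> N i" for i B
  proof -
    have "finite B"
      using fin that finite_subset by blast
    moreover have "{A. A \<subseteq> B \<and> card A = k} = {A \<in> ?X. A \<subseteq> B}"
      using that by auto
    ultimately show ?thesis
      using n_subsets[of B k] finX by (simp add: sum_of_bool_eq Int_def conj_assoc)
  qed
  have "(\<Sum>i<n. card (N i) choose k) = (\<Sum>A\<in>?X. \<Sum>i<n. of_bool (A \<subseteq> N i))"
    by (subst sum.swap) (simp add: choose)
  also have "\<dots> = (\<Sum>A\<in>?X. card (?W A))"
    by (intro sum.cong refl) (simp add: sum_of_bool_eq lessThan_def Collect_conj_eq[symmetric])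
  also have "\<dots> = (\<Sum>A\<in>?X. 1 + (\<Sum>i<n. \<Sum>j<n. if j < i then of_bool (i \<in> ?W A \<and> j \<in> ?W A) else 0))"
    by (intro sum.cong refl pairs_in_small_set[symmetric]) (use triple in auto)
  also have "\<dots> = card ?X + (\<Sum>A\<in>?X. \<Sum>i<n. \<Sum>j<n. if j < i then of_bool (i \<in> ?W A \<and> j \<in> ?W A) else 0)"
    unfolding sum.distrib by (simp only: card_eq_sum)
  also have "(\<Sum>A\<in>?X. \<Sum>i<n. \<Sum>j<n. if j < i then of_bool (i \<in> ?W A \<and> j \<in> ?W A) else 0) =
      (\<Sum>i<n. \<Sum>A\<in>?X. \<Sum>j<n. if j < i then of_bool (i \<in> ?W A \<and> j \<in> ?W A) else (0::nat))"
    by (rule sum.swap)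
  also have "\<dots> = (\<Sum>i<n. \<Sum>j<n. \<Sum>A\<in>?X. if j < i then of_bool (i \<in> ?W A \<and> j \<in> ?W A) else 0)"
    by (intro sum.cong refl sum.swap)
  also have "\<dots> = (\<Sum>i<n. \<Sum>j<n. if j < i then card (N i \<inter> N j) choose k else 0)"
    by (intro sum.cong refl) (auto simp: choose[of _ "N _ \<inter> N _"] intro!: sum.cong)
  finally show ?thesis
    by simp
qed

lemma coeff_nbhd_poly:
  assumes "finite V"
  shows "coeff (nbhd_poly V E) k = card {A \<in> nbhd_complex V E. card A = k}"
proof -
  have "finite (nbhd_complex V E)"
    using assms by (auto simp: nbhd_complex_def intro: finite_subset[of _ "Pow V"])
  then show ?thesis
    by (simp add: nbhd_poly_def coeff_sum sum.If_cases Collect_conj_eq[symmetric] Int_def conj_commute)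
qed

text \<open>\<open>coeffs\<close> strips trailing zeros, so a gapless support determines its length.
  The case \<open>D = 0\<close> is the zero polynomial, which belongs to the graph without
  vertices.\<close>

lemma coeffs_eq_map_coeff:
  fixes p :: "'a::zero poly"
  assumes "\<And>k. coeff p k \<noteq> 0 \<longleftrightarrow> k < D"
  shows "coeffs p = map (coeff p) [0..<D]"
proof (cases "D = 0")
  case True
  then have "p = 0"
    using assms by (intro poly_eqI) auto
  with True show ?thesis
    by simp
next
  case False
  then have "coeff p (D - 1) \<noteq> 0"
    using assms by simp
  moreover have "degree p = D - 1"
    using assms False by (metis Suc_pred' calculation degree_le le_antisym le_degree not_gr_zero
        not_less_eq not_le_imp_less)
  ultimately show ?thesis
    using False by (auto simp: coeffs_def)
qed

text \<open>Positions in \<open>vs\<close> replace vertices because the machine only sees the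
  matrix; their order also selects one of the two orientations of a pair.\<close>

definition nbrs :: "'a set set \<Rightarrow> 'a list \<Rightarrow> nat \<Rightarrow> nat set" where
  "nbrs E vs i = {j. j < length vs \<and> {vs ! i, vs ! j} \<in> E}"

lemma nbrs_sym: "i < length vs \<Longrightarrow> j \<in> nbrs E vs i \<Longrightarrow> i \<in> nbrs E vs j"
  by (simp add: nbrs_def insert_commute)

lemma finite_nbrs [simp]: "finite (nbrs E vs i)"
  by (simp add: nbrs_def)

definition common_nbrs :: "'a set set \<Rightarrow> 'a list \<Rightarrow> nat \<Rightarrow> nat \<Rightarrow> nat" where
  "common_nbrs E vs i j = card (nbrs E vs i \<inter> nbrs E vs j)"

definition codeg_hist :: "'a set set \<Rightarrow> 'a list \<Rightarrow> (nat \<Rightarrow> nat \<Rightarrow> bool) \<Rightarrow> nat \<Rightarrow> nat" where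
  "codeg_hist E vs R d =
    (\<Sum>u<length vs. \<Sum>v<length vs. of_bool (R u v \<and> common_nbrs E vs u v = d))"

text \<open>The coefficient of \<open>X^k\<close> in \<Sum>d \<open>h d (1 + X)^d\<close>. For
  \<open>k = 0\<close> it is the total of the histogram.\<close>

definition choose_sum :: "nat \<Rightarrow> (nat \<Rightarrow> nat) \<Rightarrow> nat \<Rightarrow> nat" where
  "choose_sum n h k = (\<Sum>d<n. h d * (d choose k))"

text \<open>
  With \<open>R\<close> the diagonal, \<open>codeg_hist\<close> is the histogram of the vertex degrees. In a graph without
  \<open>K\<^bsub>3,3\<^esub>\<close>, a set of size at least 3 lies in at most two neighborhoods, so inclusion-exclusion stops at
  pairs. By symmetry of adjacency, faces of size 1 are the non-isolated vertices and faces of size 2 are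
  the pairs with a common neighbor, which is why the sizes 1 and 2 need no such assumption.
\<close>

definition nbhd_coeff :: "'a set set \<Rightarrow> 'a list \<Rightarrow> nat \<Rightarrow> nat" where
  "nbhd_coeff E vs k =
    (let n = length vs; hp = codeg_hist E vs (\<lambda>u v. v = u); hq = codeg_hist E vs (\<lambda>u v. v < u)
     in if k = 0 then 1 else if k = 1 then n - hp 0
        else if k = 2 then choose_sum n hq 0 - hq 0
        else choose_sum n hp k - choose_sum n hq k)"

section \<open>The coefficients of the polynomial in terms of degrees and codegrees\<close>

locale listed_graph =
  fixes V :: "'a set" and E :: "'a set set" and vs :: "'a list"
  assumes simple: "simple_graph V E" and distinct: "distinct vs" and set_vs: "set vs = V"
begin

abbreviation "n \<equiv> length vs"
abbreviation "N \<equiv> nbrs E vs"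

lemma bij_vs: "bij_betw ((!) vs) {..<n} V"
  using bij_betw_nth[OF distinct] set_vs by simp

lemma finite_V: "finite V"
  using simple by (simp add: simple_graph_def)

lemma nbrs_irrefl: "i \<notin> N i"
  using simple by (auto simp: nbrs_def simple_graph_def)

text \<open>Without loops a vertex is not its own neighbor. This strict bound is what makes
  histograms and coefficient arrays of length \<open>n\<close> sufficient.\<close>

lemma common_nbrs_less:
  assumes "i < n"
  shows "common_nbrs E vs i j < n"
proof -
  have "N i \<inter> N j \<subseteq> {..<n} - {i}"
    using nbrs_irrefl by (auto simp: nbrs_def)
  then have "common_nbrs E vs i j \<le> card ({..<n} - {i})"
    unfolding common_nbrs_def by (intro card_mono) auto
  then show ?thesis
    using assms by simp
qed

lemma nbhd_image: "nbhd V E (vs ! i) = (!) vs ` N i"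
proof -
  have "V = (!) vs ` {..<n}"
    using bij_vs by (simp add: bij_betw_def)
  then show ?thesis
    by (auto simp: nbhd_def nbrs_def insert_commute[of _ "vs ! i"])
qed

text \<open>The enumeration of the vertices is a bijection, so taking images preserves sizes and
  turns sets of positions into faces.\<close>

lemma coeff_eq_card:
  "coeff (nbhd_poly V E) k = card {A. card A = k \<and> (\<exists>i<n. A \<subseteq> N i)}" (is "_ = card ?X")
proof -
  have inj: "inj_on ((!) vs) {..<n}"
    using bij_vs by (simp add: bij_betw_def)
  have X: "A \<subseteq> {..<n}" if "A \<in> ?X" for A
    using that by (auto simp: nbrs_def)
  have "inj_on ((`) ((!) vs)) ?X"
    using X inj by (auto simp: inj_on_def inj_on_image_eq_iff)
  moreover have image: "(`) ((!) vs) ` ?X = {A \<in> nbhd_complex V E. card A = k}"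
  proof (intro equalityI subsetI)
    fix B assume "B \<in> (`) ((!) vs) ` ?X"
    then obtain A i where A: "A \<in> ?X" "B = (!) vs ` A" "i < n" "A \<subseteq> N i"
      by auto
    have "B \<subseteq> nbhd V E (vs ! i)" "vs ! i \<in> V"
      using A nbhd_image set_vs by auto
    moreover have "card B = k"
      using A X inj by (simp add: card_image inj_on_subset)
    ultimately show "B \<in> {A \<in> nbhd_complex V E. card A = k}"
      by (auto simp: nbhd_complex_def nbhd_def)
  next
    fix B assume B: "B \<in> {A \<in> nbhd_complex V E. card A = k}"
    then obtain v where "v \<in> V" "B \<subseteq> nbhd V E v"
      by (auto simp: nbhd_complex_def)
    then obtain i where "i < n" "B \<subseteq> (!) vs ` N i"
      using set_vs nbhd_image by (metis in_set_conv_nth)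
    then obtain A where A: "A \<subseteq> N i" "B = (!) vs ` A"
      by (meson subset_imageE)
    moreover have "N i \<subseteq> {..<n}"
      by (auto simp: nbrs_def)
    ultimately have "card A = k"
      using B inj by (metis (mono_tags, lifting) card_image inj_on_subset mem_Collect_eq order_trans)
    then show "B \<in> (`) ((!) vs) ` ?X"
      using A \<open>i < n\<close> by auto
  qed
  ultimately show ?thesis
    unfolding coeff_nbhd_poly[OF finite_V] by (simp only: card_image flip: image)
qed

text \<open>Each pair is recorded under exactly one \<open>d\<close>, which lies in the range of
  summation by \<open>common_nbrs_less\<close>.\<close>

lemma choose_sum_codeg_hist:
  "choose_sum n (codeg_hist E vs R) k =
    (\<Sum>u<n. \<Sum>v<n. if R u v then common_nbrs E vs u v choose k else 0)"
proof -
  have "choose_sum n (codeg_hist E vs R) k =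
      (\<Sum>d<n. \<Sum>u<n. \<Sum>v<n. of_bool (R u v \<and> common_nbrs E vs u v = d) * (d choose k))"
    by (simp add: choose_sum_def codeg_hist_def sum_distrib_right)
  also have "\<dots> = (\<Sum>u<n. \<Sum>v<n. \<Sum>d<n. of_bool (R u v \<and> common_nbrs E vs u v = d) * (d choose k))"
    by (subst sum.swap) (intro sum.cong refl sum.swap)
  also have "\<dots> = (\<Sum>u<n. \<Sum>v<n. if R u v then common_nbrs E vs u v choose k else 0)"
  proof (intro sum.cong refl)
    fix u v assume "u \<in> {..<n}"
    then have "common_nbrs E vs u v < n"
      using common_nbrs_less by simp
    moreover have "(\<Sum>d<n. of_bool (R u v \<and> common_nbrs E vs u v = d) * (d choose k)) =
        (\<Sum>d<n. if d = common_nbrs E vs u v then if R u v then d choose k else 0 else 0)"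
      by (intro sum.cong refl) auto
    ultimately show "(\<Sum>d<n. of_bool (R u v \<and> common_nbrs E vs u v = d) * (d choose k)) =
        (if R u v then common_nbrs E vs u v choose k else 0)"
      by simp
  qed
  finally show ?thesis .
qed

text \<open>Without a vertex there is no neighborhood, and then not even the empty set is a
  face.\<close>

lemma coeff_0: "n > 0 \<Longrightarrow> coeff (nbhd_poly V E) 0 = 1"
proof -
  assume "n > 0"
  have "{A. card A = 0 \<and> (\<exists>i<n. A \<subseteq> N i)} = {{}}"
    using \<open>n > 0\<close> by (auto dest: finite_subset[OF _ finite_nbrs])
  then show ?thesis
    unfolding coeff_eq_card by simp
qed

lemma coeff_1: "coeff (nbhd_poly V E) 1 = n - codeg_hist E vs (\<lambda>u v. v = u) 0"
proof -
  \<comment> \<open>On the diagonal a codegree is a degree, so entry 0 counts the isolated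
    vertices.\<close>
  have "codeg_hist E vs (\<lambda>u v. v = u) 0 = (\<Sum>u<n. \<Sum>v<n. if v = u then of_bool (N v = {}) else 0)"
    unfolding codeg_hist_def common_nbrs_def by (intro sum.cong refl) auto
  also have "\<dots> = card {u \<in> {..<n}. N u = {}}"
    by (simp add: sum_of_bool_eq Int_def)
  finally have h: "codeg_hist E vs (\<lambda>u v. v = u) 0 = card {u \<in> {..<n}. N u = {}}" .
  have "{A. card A = 1 \<and> (\<exists>i<n. A \<subseteq> N i)} = (\<lambda>u. {u}) ` ({..<n} - {u \<in> {..<n}. N u = {}})"
  proof (intro equalityI subsetI)
    fix A assume "A \<in> {A. card A = 1 \<and> (\<exists>i<n. A \<subseteq> N i)}"
    then obtain u i where "A = {u}" "i < n" "u \<in> N i"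
      by (auto simp: card_1_singleton_iff)
    moreover from this have "i \<in> N u" "u < n"
      using nbrs_sym by (auto simp: nbrs_def)
    ultimately show "A \<in> (\<lambda>u. {u}) ` ({..<n} - {u \<in> {..<n}. N u = {}})"
      by auto
  next
    fix A assume "A \<in> (\<lambda>u. {u}) ` ({..<n} - {u \<in> {..<n}. N u = {}})"
    then obtain u i where "A = {u}" "u < n" "i \<in> N u"
      by auto
    moreover from this have "u \<in> N i" "i < n"
      using nbrs_sym by (auto simp: nbrs_def)
    ultimately show "A \<in> {A. card A = 1 \<and> (\<exists>i<n. A \<subseteq> N i)}"
      by auto
  qed
  then show ?thesis
    unfolding coeff_eq_card h by (simp add: card_image card_Diff_subset[of "{u \<in> {..<n}. N u = {}}"] del: mem_Collect_eq lessThan_iff)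
qed

lemma coeff_2:
  "coeff (nbhd_poly V E) 2 = choose_sum n (codeg_hist E vs (\<lambda>u v. v < u)) 0 - codeg_hist E vs (\<lambda>u v. v < u) 0"
proof -
  let ?P = "{(u, v). u < n \<and> v < u}" and ?Z = "{(u, v). u < n \<and> v < u \<and> N u \<inter> N v = {}}"
  have finP: "finite ?P"
    by (rule finite_subset[of _ "{..<n} \<times> {..<n}"]) auto
  have card_pairs: "(\<Sum>u<n. \<Sum>v<n. of_bool (v < u \<and> Q u v)) = card {(u, v). u < n \<and> v < u \<and> Q u v}"
    for Q :: "nat \<Rightarrow> nat \<Rightarrow> bool"
  proof -
    have "{(u, v). u < n \<and> v < u \<and> Q u v} = {p \<in> {..<n} \<times> {..<n}. snd p < fst p \<and> Q (fst p) (snd p)}"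
      by auto
    moreover have "(\<Sum>u<n. \<Sum>v<n. of_bool (v < u \<and> Q u v) :: nat) =
        (\<Sum>p\<in>{..<n} \<times> {..<n}. of_bool (snd p < fst p \<and> Q (fst p) (snd p)))"
      by (simp only: sum.cartesian_product split_def)
    moreover have "(\<Sum>p\<in>{..<n} \<times> {..<n}. of_bool (snd p < fst p \<and> Q (fst p) (snd p))) =
        card {p \<in> {..<n} \<times> {..<n}. snd p < fst p \<and> Q (fst p) (snd p)}"
      by (simp add: sum_of_bool_eq Int_def)
    ultimately show ?thesis
      by (simp only:)
  qed
  have h: "codeg_hist E vs (\<lambda>u v. v < u) 0 = card ?Z"
    using card_pairs[of "\<lambda>u v. N u \<inter> N v = {}"] by (simp add: codeg_hist_def common_nbrs_def)
  \<comment> \<open>Since \<open>d choose 0 = 1\<close>, the sum for \<open>k = 0\<close> counts all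
    pairs; entry 0 of the histogram counts those without a common neighbor.\<close>
  have c: "choose_sum n (codeg_hist E vs (\<lambda>u v. v < u)) 0 = card ?P"
    using card_pairs[of "\<lambda>u v. True"] unfolding choose_sum_codeg_hist binomial_n_0 by (simp add: of_bool_def)
  have "{A. card A = 2 \<and> (\<exists>i<n. A \<subseteq> N i)} = (\<lambda>(u, v). {u, v}) ` (?P - ?Z)"
  proof (intro equalityI subsetI)
    fix A assume "A \<in> {A. card A = 2 \<and> (\<exists>i<n. A \<subseteq> N i)}"
    then obtain i where i: "card A = 2" "i < n" "A \<subseteq> N i"
      by blast
    obtain x y where xy: "A = {x, y}" "x \<noteq> y"
      using i(1) by (meson card_2_iff)
    define u v where "u = max x y" and "v = min x y"
    have "A = {u, v}" "v < u" "i < n" "u \<in> N i" "v \<in> N i"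
      using xy i by (auto simp: u_def v_def max_def min_def)
    moreover from this have "i \<in> N u" "i \<in> N v" "u < n"
      using nbrs_sym by (blast, blast, simp add: nbrs_def)
    ultimately show "A \<in> (\<lambda>(u, v). {u, v}) ` (?P - ?Z)"
      by (intro image_eqI[of A _ "(u, v)"]) auto
  next
    fix A assume "A \<in> (\<lambda>(u, v). {u, v}) ` (?P - ?Z)"
    then obtain u v i where uv: "A = {u, v}" "v < u" "u < n" "i \<in> N u" "i \<in> N v"
      by auto
    moreover from this have "u \<in> N i" "v \<in> N i" "i < n"
      using nbrs_sym by (blast, meson less_trans nbrs_sym, simp add: nbrs_def)
    ultimately show "A \<in> {A. card A = 2 \<and> (\<exists>i<n. A \<subseteq> N i)}"
      by auto
  qed
  moreover have "inj_on (\<lambda>(u, v). {u, v}) (?P - ?Z)"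
    by (auto simp: inj_on_def doubleton_eq_iff)
  moreover have "card (?P - ?Z) = card ?P - card ?Z"
    using finP by (intro card_Diff_subset) (auto intro: finite_subset[of _ ?P])
  ultimately show ?thesis
    unfolding coeff_eq_card h c by (simp add: card_image)
qed

text \<open>Three neighborhoods containing \<open>A\<close> and three elements of \<open>A\<close>
  would span a K33. The counting identity has the form of a sum equal to a total, so the truncated
  subtraction is exact.\<close>

lemma coeff_ge_3:
  assumes no_K33: "\<And>a1 a2 a3 b1 b2 b3. a1 \<noteq> a2 \<Longrightarrow> a1 \<noteq> a3 \<Longrightarrow> a2 \<noteq> a3 \<Longrightarrow>
      b1 \<noteq> b2 \<Longrightarrow> b1 \<noteq> b3 \<Longrightarrow> b2 \<noteq> b3 \<Longrightarrow>
      (\<And>a b. a \<in> {a1, a2, a3} \<Longrightarrow> b \<in> {b1, b2, b3} \<Longrightarrow> {a, b} \<in> E) \<Longrightarrow> False"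
    and "k \<ge> 3"
  shows "coeff (nbhd_poly V E) k = choose_sum n (codeg_hist E vs (\<lambda>u v. v = u)) k -
      choose_sum n (codeg_hist E vs (\<lambda>u v. v < u)) k"
proof -
  have small: "card {i. i < n \<and> A \<subseteq> N i} \<le> 2" if cardA: "card A = k" for A
  proof (rule ccontr)
    assume "\<not> card {i. i < n \<and> A \<subseteq> N i} \<le> 2"
    then obtain W where W: "W \<subseteq> {i. i < n \<and> A \<subseteq> N i}" "card W = 3"
      using obtain_subset_with_card_n[of 3 "{i. i < n \<and> A \<subseteq> N i}"] by auto
    obtain B where B: "B \<subseteq> A" "card B = 3"
      using obtain_subset_with_card_n[of 3 A] cardA \<open>k \<ge> 3\<close> by metis
    obtain a1 a2 a3 where a: "W = {a1, a2, a3}" "a1 \<noteq> a2" "a1 \<noteq> a3" "a2 \<noteq> a3"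
      using W(2) by (auto simp: card_3_iff)
    obtain b1 b2 b3 where b: "B = {b1, b2, b3}" "b1 \<noteq> b2" "b1 \<noteq> b3" "b2 \<noteq> b3"
      using B(2) by (auto simp: card_3_iff)
    have adj: "b < n \<and> {vs ! a, vs ! b} \<in> E" if "a \<in> W" "b \<in> B" for a b
      using that W B by (auto simp: nbrs_def)
    have len: "a < n" if "a \<in> W" for a
      using that W by auto
    show False
    proof (rule no_K33[of "vs ! a1" "vs ! a2" "vs ! a3" "vs ! b1" "vs ! b2" "vs ! b3"])
      fix x y assume "x \<in> {vs ! a1, vs ! a2, vs ! a3}" "y \<in> {vs ! b1, vs ! b2, vs ! b3}"
      then show "{x, y} \<in> E"
        using adj a(1) b(1) by auto
    qed (use a b adj[of a1] len distinct in \<open>auto simp: nth_eq_iff_index_eq\<close>)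
  qed
  have "card {A. card A = k \<and> (\<exists>i<n. A \<subseteq> N i)} +
      (\<Sum>i<n. \<Sum>j<n. if j < i then card (N i \<inter> N j) choose k else 0) = (\<Sum>i<n. card (N i) choose k)"
    using small by (intro sum_choose_overlaps) auto
  then show ?thesis
    unfolding coeff_eq_card choose_sum_codeg_hist common_nbrs_def by simp
qed

text \<open>Subsets of faces are faces, so the sizes that occur have no gaps; a face lies in a
  neighborhood and therefore has fewer than \<open>n\<close> elements.\<close>

lemma coeff_pos_iff: "\<exists>D\<le>n. \<forall>k. coeff (nbhd_poly V E) k \<noteq> 0 \<longleftrightarrow> k < D"
proof -
  let ?X = "\<lambda>k. {A. card A = k \<and> (\<exists>i<n. A \<subseteq> N i)}"
  have fin: "finite (?X k)" for k
    by (rule finite_subset[of _ "\<Union>i<n. Pow (N i)"]) auto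
  then have nz: "coeff (nbhd_poly V E) k \<noteq> 0 \<longleftrightarrow> ?X k \<noteq> {}" for k
    unfolding coeff_eq_card using card_0_eq[OF fin, of k] by (simp only: simp_thms)
  have less: "k < n" if "?X k \<noteq> {}" for k
  proof -
    obtain A i where A: "card A = k" "i < n" "A \<subseteq> N i"
      using \<open>?X k \<noteq> {}\<close> by blast
    then have "k \<le> common_nbrs E vs i i"
      by (auto simp: common_nbrs_def intro: card_mono)
    then show ?thesis
      using common_nbrs_less[OF \<open>i < n\<close>, of i] by simp
  qed
  have down: "?X j \<noteq> {}" if X: "?X k \<noteq> {}" and "j \<le> k" for j k
  proof -
    obtain A i where A: "card A = k" "i < n" "A \<subseteq> N i"
      using X by blast
    obtain B where "B \<subseteq> A" "card B = j"
      using obtain_subset_with_card_n[of j A] A \<open>j \<le> k\<close> by metis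
    with A show ?thesis
      by blast
  qed
  define D where "D = (LEAST k. ?X k = {})"
  have Xn: "?X n = {}"
    using less[of n] by blast
  then have D: "?X D = {}" "D \<le> n"
    unfolding D_def by - (rule LeastI, assumption, rule Least_le, assumption)
  have "?X k \<noteq> {} \<longleftrightarrow> k < D" for k
  proof
    assume "?X k \<noteq> {}"
    then have "\<not> D \<le> k"
      using down[of k D] D(1) by argo
    then show "k < D"
      by simp
  next
    assume "k < D"
    then show "?X k \<noteq> {}"
      unfolding D_def by (rule not_less_Least)
  qed
  then have "\<forall>k. coeff (nbhd_poly V E) k \<noteq> 0 \<longleftrightarrow> k < D"
    unfolding nz ..
  with D(2) show ?thesis
    by (intro exI conjI)
qed

end

section \<open>A loop language and its compilation\<close>

datatype com =
    Assign nat nat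
  | Plus nat nat nat
  | Minus nat nat nat
  | Fetch nat nat nat
  | Update nat nat nat
  | Input nat
  | Output nat
  | Seq com com (infixr \<open>;;\<close> 60)
  | For nat com

record state =
  var :: "nat \<Rightarrow> nat"
  arr :: "nat \<Rightarrow> nat \<Rightarrow> nat"
  source :: "nat list"
  result :: "nat list"

abbreviation set_var :: "nat \<Rightarrow> nat \<Rightarrow> state \<Rightarrow> state" where
  "set_var x k s \<equiv> s\<lparr>var := (var s)(x := k)\<rparr>"

abbreviation incr :: "nat \<Rightarrow> state \<Rightarrow> state" where
  "incr x s \<equiv> set_var x (Suc (var s x)) s"

text \<open>A loop reads its bound once on entry, while the compiled loop compares with the register
  in every round. Both agree for well-formed programs.\<close>

primrec sem :: "com \<Rightarrow> state \<Rightarrow> state" where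
  "sem (Assign x c) s = set_var x c s"
| "sem (Plus x y z) s = set_var x (var s y + var s z) s"
| "sem (Minus x y z) s = set_var x (var s y - var s z) s"
| "sem (Fetch x a i) s = set_var x (arr s a (var s i)) s"
| "sem (Update a i x) s = s\<lparr>arr := (arr s)(a := (arr s a)(var s i := var s x))\<rparr>"
| "sem (Input x) s = (set_var x (case source s of [] \<Rightarrow> 0 | k # _ \<Rightarrow> k) s)\<lparr>source := tl (source s)\<rparr>"
| "sem (Output x) s = s\<lparr>result := result s @ [var s x]\<rparr>"
| "sem (c1 ;; c2) s = sem c2 (sem c1 s)"
| "sem (For x c) s = ((\<lambda>t. incr x (sem c t)) ^^ var s 0) (set_var x 0 s)"

primrec written_vars :: "com \<Rightarrow> nat set" where
  "written_vars (Assign x c) = {x}"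
| "written_vars (Plus x y z) = {x}"
| "written_vars (Minus x y z) = {x}"
| "written_vars (Fetch x a i) = {x}"
| "written_vars (Update a i x) = {}"
| "written_vars (Input x) = {x}"
| "written_vars (Output x) = {}"
| "written_vars (c1 ;; c2) = written_vars c1 \<union> written_vars c2"
| "written_vars (For x c) = insert x (written_vars c)"

primrec written_arrs :: "com \<Rightarrow> nat set" where
  "written_arrs (Assign x c) = {}"
| "written_arrs (Plus x y z) = {}"
| "written_arrs (Minus x y z) = {}"
| "written_arrs (Fetch x a i) = {}"
| "written_arrs (Update a i x) = {a}"
| "written_arrs (Input x) = {}"
| "written_arrs (Output x) = {}"
| "written_arrs (c1 ;; c2) = written_arrs c1 \<union> written_arrs c2"
| "written_arrs (For x c) = written_arrs c"

primrec prints :: "com \<Rightarrow> bool" where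
  "prints (Assign x c) = False"
| "prints (Plus x y z) = False"
| "prints (Minus x y z) = False"
| "prints (Fetch x a i) = False"
| "prints (Update a i x) = False"
| "prints (Input x) = False"
| "prints (Output x) = True"
| "prints (c1 ;; c2) = (prints c1 \<or> prints c2)"
| "prints (For x c) = prints c"

text \<open>
  The bound of every loop is the variable 0, which loop bodies do not change. Hence the number of
  machine steps depends only on the value of that variable.
\<close>

primrec well_formed :: "com \<Rightarrow> bool" where
  "well_formed (Assign x c) = True"
| "well_formed (Plus x y z) = True"
| "well_formed (Minus x y z) = True"
| "well_formed (Fetch x a i) = (1 \<le> a \<and> a \<le> 6)"
| "well_formed (Update a i x) = (1 \<le> a \<and> a \<le> 6)"
| "well_formed (Input x) = True"
| "well_formed (Output x) = True"
| "well_formed (c1 ;; c2) = (well_formed c1 \<and> well_formed c2 \<and> 0 \<notin> written_vars c1)"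
| "well_formed (For x c) = (well_formed c \<and> x \<noteq> 0 \<and> 0 \<notin> written_vars c \<and> x \<notin> written_vars c)"

section \<open>Frame and invariant rules for the loop language\<close>

lemma sem_var: "x \<notin> written_vars c \<Longrightarrow> var (sem c s) x = var s x"
proof (induction c arbitrary: s)
  case (For y c)
  have "var (((\<lambda>t. incr y (sem c t)) ^^ k) (set_var y 0 s)) x = var s x" for k
    using For by (induction k) auto
  then show ?case by simp
qed auto

lemma sem_arr: "a \<notin> written_arrs c \<Longrightarrow> arr (sem c s) a = arr s a"
proof (induction c arbitrary: s)
  case (For y c)
  have "arr (((\<lambda>t. incr y (sem c t)) ^^ k) (set_var y 0 s)) a = arr s a" for k
    using For by (induction k) auto
  then show ?case by simp
qed auto

lemma sem_result: "\<not> prints c \<Longrightarrow> result (sem c s) = result s"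
proof (induction c arbitrary: s)
  case (For y c)
  have "result (((\<lambda>t. incr y (sem c t)) ^^ k) (set_var y 0 s)) = result s" for k
    using For by (induction k) auto
  then show ?case by simp
qed auto

text \<open>The step case supplies the value of the counter and all frame facts, so an invariant
  need only speak of what the body changes.\<close>

lemma For_invariant:
  assumes wf: "well_formed (For x c)"
    and init: "I 0 (set_var x 0 s)"
    and step: "\<And>i t. \<lbrakk>i < var s 0; I i t; var t x = i;
        \<And>y. y \<notin> written_vars (For x c) \<Longrightarrow> var t y = var s y;
        \<And>a. a \<notin> written_arrs c \<Longrightarrow> arr t a = arr s a\<rbrakk> \<Longrightarrow> I (Suc i) (incr x (sem c t))"
  shows "I (var s 0) (sem (For x c) s)"
proof -
  define F where "F i = ((\<lambda>t. incr x (sem c t)) ^^ i) (set_var x 0 s)" for i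
  have "I i (F i) \<and> var (F i) x = i \<and> (\<forall>y. y \<notin> written_vars (For x c) \<longrightarrow> var (F i) y = var s y) \<and>
      (\<forall>a. a \<notin> written_arrs c \<longrightarrow> arr (F i) a = arr s a)" if "i \<le> var s 0" for i
    using that
  proof (induction i)
    case 0
    then show ?case
      using init by (simp add: F_def)
  next
    case (Suc i)
    then have IH: "I i (F i)" "var (F i) x = i"
        "\<forall>y. y \<notin> written_vars (For x c) \<longrightarrow> var (F i) y = var s y"
        "\<forall>a. a \<notin> written_arrs c \<longrightarrow> arr (F i) a = arr s a"
      by simp_all
    have F: "F (Suc i) = incr x (sem c (F i))"
      by (simp add: F_def)
    have "I (Suc i) (F (Suc i))"
      unfolding F using Suc.prems IH by (intro step) auto
    then show ?case
      using IH wf by (simp add: F sem_var sem_arr)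
  qed
  then show ?thesis
    by (simp add: F_def)
qed

section \<open>Memory layout and compilation\<close>

text \<open>
  Cells are interleaved modulo 8: the variable \<open>x\<close> is kept in the register \<open>8 x\<close>, the entry \<open>i\<close> of
  the array \<open>a \<in> {1..6}\<close> in the register \<open>8 i + a\<close>, and the registers \<open>7\<close> and \<open>15\<close> are scratch.
\<close>

definition address :: "nat \<Rightarrow> nat \<Rightarrow> instr list" where
  "address a i = [Add 7 (8 * i) (8 * i), Add 7 7 7, Add 7 7 7, Const 15 a, Add 7 7 15]"

text \<open>Jump targets are absolute, hence the start position \<open>b\<close>. A loop jumps to
  its test before the first round, so that the bound 0 is handled; \<open>Const 7 1\<close> makes
  this jump unconditional. The test starts after 3 header, all body and 2 increment
  instructions.\<close>

primrec code :: "com \<Rightarrow> nat \<Rightarrow> instr list" where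
  "code (Assign x c) b = [Const (8 * x) c]"
| "code (Plus x y z) b = [Add (8 * x) (8 * y) (8 * z)]"
| "code (Minus x y z) b = [Sub (8 * x) (8 * y) (8 * z)]"
| "code (Fetch x a i) b = address a i @ [Load (8 * x) 7]"
| "code (Update a i x) b = address a i @ [Store 7 (8 * x)]"
| "code (Input x) b = [Read (8 * x)]"
| "code (Output x) b = [Print (8 * x)]"
| "code (c1 ;; c2) b = code c1 b @ code c2 (b + length (code c1 b))"
| "code (For x c) b =
    [Const (8 * x) 0, Const 7 1, JumpPos 7 (b + 5 + length (code c (b + 3)))] @ code c (b + 3) @
    [Const 7 1, Add (8 * x) (8 * x) 7, Sub 7 0 (8 * x), JumpPos 7 (b + 3)]"

text \<open>For a loop: 3 instructions to enter, 2 for each of the \<open>n + 1\<close> tests, and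
  in each round the body and 2 for the increment.\<close>

primrec steps :: "com \<Rightarrow> nat \<Rightarrow> nat" where
  "steps (Assign x c) n = 1"
| "steps (Plus x y z) n = 1"
| "steps (Minus x y z) n = 1"
| "steps (Fetch x a i) n = 6"
| "steps (Update a i x) n = 6"
| "steps (Input x) n = 1"
| "steps (Output x) n = 1"
| "steps (c1 ;; c2) n = steps c1 n + steps c2 n"
| "steps (For x c) n = 5 + n * (steps c n + 4)"

text \<open>Instructions are counted here without their costs; \<open>run_of_stepn\<close> converts
  the count into logarithmic cost.\<close>

primrec stepn :: "instr list \<Rightarrow> nat \<Rightarrow> config \<Rightarrow> config \<Rightarrow> bool" where
  "stepn P 0 s s' \<longleftrightarrow> s' = s"
| "stepn P (Suc k) s s' \<longleftrightarrow> pc s < length P \<and> stepn P k (exec (P ! pc s) s) s'"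

lemma stepn_add: "stepn P j s s' \<Longrightarrow> stepn P k s' s'' \<Longrightarrow> stepn P (j + k) s s''"
  by (induction j arbitrary: s) auto

definition sits :: "instr list \<Rightarrow> nat \<Rightarrow> instr list \<Rightarrow> bool" where
  "sits P b xs \<longleftrightarrow> (\<exists>pre post. P = pre @ xs @ post \<and> length pre = b)"

lemma sits_append:
  assumes "sits P b (xs @ ys)"
  shows "sits P b xs" "sits P (b + length xs) ys"
proof -
  obtain pre post where P: "P = pre @ (xs @ ys) @ post" "length pre = b"
    using assms by (auto simp: sits_def)
  show "sits P b xs"
    unfolding sits_def using P by (intro exI[of _ pre] exI[of _ "ys @ post"]) simp
  show "sits P (b + length xs) ys"
    unfolding sits_def using P by (intro exI[of _ "pre @ xs"] exI[of _ post]) simp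
qed

lemma sits_nth:
  assumes "sits P b xs" "i < length xs"
  shows "P ! (b + i) = xs ! i" "b + i < length P"
  using assms by (auto simp: sits_def nth_append)

fun is_jump :: "instr \<Rightarrow> bool" where
  "is_jump (JumpPos j m) = True"
| "is_jump _ = False"

lemma pc_exec: "\<not> is_jump i \<Longrightarrow> pc (exec i s) = Suc (pc s)"
  by (cases i) (auto simp: put_def)

lemma stepn_straight:
  assumes "sits P (pc s) xs" "\<forall>i\<in>set xs. \<not> is_jump i"
  shows "stepn P (length xs) s (fold exec xs s) \<and> pc (fold exec xs s) = pc s + length xs"
  using assms
proof (induction xs arbitrary: s)
  case (Cons i xs)
  have i: "P ! pc s = i" "pc s < length P"
    using sits_nth[OF Cons.prems(1), of 0] by auto
  have "sits P (pc s + 1) xs"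
    using sits_append(2)[of P "pc s" "[i]" xs] Cons.prems(1) by simp
  with Cons.prems(2) have "stepn P (length xs) (exec i s) (fold exec xs (exec i s)) \<and>
      pc (fold exec xs (exec i s)) = pc (exec i s) + length xs"
    by (intro Cons.IH) (auto simp: pc_exec)
  then show ?case
    using i Cons.prems(2) by (auto simp: pc_exec)
qed simp

text \<open>Registers congruent to 7 modulo 8 are left unconstrained, so the scratch registers may
  hold anything.\<close>

definition represents :: "config \<Rightarrow> state \<Rightarrow> bool" where
  "represents s S \<longleftrightarrow> (\<forall>x. mem s (8 * x) = var S x) \<and>
     (\<forall>a i. 1 \<le> a \<longrightarrow> a \<le> 6 \<longrightarrow> mem s (8 * i + a) = arr S a i) \<and>
     inp s = source S \<and> out s = result S"

definition reaches :: "instr list \<Rightarrow> nat \<Rightarrow> state \<Rightarrow> nat \<Rightarrow> nat \<Rightarrow> state \<Rightarrow> bool" where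
  "reaches P b S k e S' \<longleftrightarrow> (\<forall>s. represents s S \<and> pc s = b \<longrightarrow>
     (\<exists>s'. stepn P k s s' \<and> represents s' S' \<and> pc s' = e))"

lemma reaches_trans:
  "reaches P b S j e S' \<Longrightarrow> reaches P e S' k f S'' \<Longrightarrow> reaches P b S (j + k) f S''"
  unfolding reaches_def using stepn_add by fast

lemma reaches_straight:
  assumes "sits P b xs" "\<forall>i\<in>set xs. \<not> is_jump i"
    and "\<And>s. represents s S \<Longrightarrow> represents (fold exec xs s) S'"
  shows "reaches P b S (length xs) (b + length xs) S'"
  unfolding reaches_def using assms stepn_straight by metis

lemma cell_eq_iff:
  assumes "1 \<le> a" "a \<le> 6" "1 \<le> c" "c \<le> 6"
  shows "8 * i + a = 8 * j + c \<longleftrightarrow> i = j \<and> a = (c :: nat)"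
  using assms by presburger

lemma var_cell: "8 * x \<noteq> (7 :: nat)" "8 * x \<noteq> (15 :: nat)" "(7 :: nat) \<noteq> 8 * x" "(15 :: nat) \<noteq> 8 * x"
  by presburger+

lemma arr_cell:
  assumes "1 \<le> a" "a \<le> (6 :: nat)"
  shows "8 * i + a \<noteq> 8 * x" "8 * i + a \<noteq> 7" "8 * i + a \<noteq> 15"
    "8 * x \<noteq> 8 * i + a" "7 \<noteq> 8 * i + a" "15 \<noteq> 8 * i + a"
  using assms by presburger+

lemma length_address [simp]: "length (address a i) = 5"
  by (simp add: address_def)

lemma address_effect:
  "fold exec (address a i) s =
    s\<lparr>pc := Suc (Suc (Suc (Suc (Suc (pc s))))), mem := (mem s)(15 := a, 7 := 8 * mem s (8 * i) + a)\<rparr>"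
proof -
  have eight: "m + m + (m + m) + (m + m + (m + m)) = 8 * m" for m :: nat
    by simp
  show ?thesis
    by (simp add: address_def put_def fun_upd_twist var_cell eight)
qed

lemma represents_set_var:
  assumes "represents s S" "inp s' = source S'" "out s' = result S'" "arr S' = arr S"
    "var S' = (var S)(x := k)" "mem s' (8 * x) = k"
    "\<And>j. j \<noteq> 8 * x \<Longrightarrow> j \<noteq> 7 \<Longrightarrow> j \<noteq> 15 \<Longrightarrow> mem s' j = mem s j"
  shows "represents s' S'"
  unfolding represents_def
proof (intro conjI allI impI)
  show "mem s' (8 * y) = var S' y" for y
    using assms(1,5,6) assms(7)[of "8 * y"] var_cell by (cases "y = x") (auto simp: represents_def)
  show "mem s' (8 * i + a) = arr S' a i" if "1 \<le> a" "a \<le> 6" for a i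
    using assms(1,4) assms(7)[of "8 * i + a"] arr_cell[OF that, of i] that by (simp add: represents_def)
qed (use assms in auto)

lemma represents_set_arr:
  assumes "represents s S" "inp s' = source S'" "out s' = result S'" "var S' = var S"
    "arr S' = (arr S)(a := (arr S a)(i := k))" "1 \<le> a" "a \<le> 6" "mem s' (8 * i + a) = k"
    "\<And>j. j \<noteq> 8 * i + a \<Longrightarrow> j \<noteq> 7 \<Longrightarrow> j \<noteq> 15 \<Longrightarrow> mem s' j = mem s j"
  shows "represents s' S'"
  unfolding represents_def
proof (intro conjI allI impI)
  show "mem s' (8 * y) = var S' y" for y
    using assms(1,4) assms(9)[of "8 * y"] by (simp add: represents_def var_cell arr_cell[OF assms(6,7)])
  show "mem s' (8 * j + c) = arr S' c j" if "1 \<le> c" "c \<le> 6" for c j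
    using assms(1,5,8) assms(9)[of "8 * j + c"] arr_cell[OF that, of j] that cell_eq_iff[OF that assms(6,7), of j i]
    by (cases "c = a \<and> j = i") (auto simp: represents_def)
qed (use assms in auto)

lemma code_correct:
  assumes "sits P b (code c b)" "well_formed c"
  shows "reaches P b S (steps c (var S 0)) (b + length (code c b)) (sem c S)"
  using assms
proof (induction c arbitrary: b S)
  case (Assign x k)
  have "represents (fold exec (code (Assign x k) b) s) (sem (Assign x k) S)" if "represents s S" for s
    by (rule represents_set_var[OF that, where x = x and k = "k"])
       (use that in \<open>simp_all add: put_def represents_def input_head_def\<close>)
  then show ?case
    using reaches_straight[OF Assign(1), of S] by simp
next
  case (Plus x y z)
  have "represents (fold exec (code (Plus x y z) b) s) (sem (Plus x y z) S)" if "represents s S" for s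
    by (rule represents_set_var[OF that, where x = x and k = "var S y + var S z"])
       (use that in \<open>simp_all add: put_def represents_def input_head_def\<close>)
  then show ?case
    using reaches_straight[OF Plus(1), of S] by simp
next
  case (Minus x y z)
  have "represents (fold exec (code (Minus x y z) b) s) (sem (Minus x y z) S)" if "represents s S" for s
    by (rule represents_set_var[OF that, where x = x and k = "var S y - var S z"])
       (use that in \<open>simp_all add: put_def represents_def input_head_def\<close>)
  then show ?case
    using reaches_straight[OF Minus(1), of S] by simp
next
  case (Input x)
  have "represents (fold exec (code (Input x) b) s) (sem (Input x) S)" if "represents s S" for s
    by (rule represents_set_var[OF that, where x = x and k = "case source S of [] \<Rightarrow> 0 | k # _ \<Rightarrow> k"])
       (use that in \<open>simp_all add: put_def represents_def input_head_def\<close>)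
  then show ?case
    using reaches_straight[OF Input(1), of S] by simp
next
  case (Output x)
  have "represents (fold exec (code (Output x) b) s) (sem (Output x) S)" if "represents s S" for s
    using that by (simp add: represents_def)
  then show ?case
    using reaches_straight[OF Output(1), of S] by simp
next
  case (Fetch x a i)
  have a: "1 \<le> a" "a \<le> 6"
    using Fetch(2) by simp_all
  have "represents (fold exec (address a i @ [Load (8 * x) 7]) s) (sem (Fetch x a i) S)"
    if "represents s S" for s
    using that a
    by (intro represents_set_var[OF that, where x = x and k = "arr S a (var S i)"])
       (simp_all add: address_effect put_def represents_def var_cell arr_cell[OF a])
  moreover have "\<forall>j\<in>set (code (Fetch x a i) b). \<not> is_jump j"
    by (simp add: address_def)
  ultimately show ?case
    using reaches_straight[OF Fetch(1), of S "sem (Fetch x a i) S"] by simp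
next
  case (Update a i x)
  have a: "1 \<le> a" "a \<le> 6"
    using Update(2) by simp_all
  have "represents (fold exec (address a i @ [Store 7 (8 * x)]) s) (sem (Update a i x) S)"
    if "represents s S" for s
    using that a
    by (intro represents_set_arr[OF that, where a = a and i = "var S i" and k = "var S x"])
       (simp_all add: address_effect put_def represents_def var_cell arr_cell[OF a])
  moreover have "\<forall>j\<in>set (code (Update a i x) b). \<not> is_jump j"
    by (simp add: address_def)
  ultimately show ?case
    using reaches_straight[OF Update(1), of S "sem (Update a i x) S"] by simp
next
  case (Seq c1 c2)
  have "reaches P b S (steps c1 (var S 0)) (b + length (code c1 b)) (sem c1 S)"
    using Seq.prems sits_append by (intro Seq.IH) auto
  moreover have "reaches P (b + length (code c1 b)) (sem c1 S) (steps c2 (var (sem c1 S) 0))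
      (b + length (code c1 b) + length (code c2 (b + length (code c1 b)))) (sem c2 (sem c1 S))"
    using Seq.prems sits_append by (intro Seq.IH) auto
  \<comment> \<open>The first part leaves the loop bound alone, so both parts are timed with the
    same \<open>n\<close>.\<close>
  moreover have "var (sem c1 S) 0 = var S 0"
    using Seq.prems by (simp add: sem_var)
  ultimately show ?case
    using reaches_trans by (fastforce simp: add.assoc)
next
  case (For x c)
  define l where "l = length (code c (b + 3))"
  define n where "n = var S 0"
  define F where "F i = ((\<lambda>t. incr x (sem c t)) ^^ i) (set_var x 0 S)" for i
  have F_Suc: "F (Suc i) = incr x (sem c (F i))" for i
    by (simp add: F_def)
  have F_var: "var (F i) x = i \<and> var (F i) 0 = n" for i
    using For.prems by (induction i) (auto simp: F_Suc sem_var, auto simp: F_def n_def)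
  note placed = For.prems(1)[unfolded code.simps]
  have head: "sits P b [Const (8 * x) 0, Const 7 1, JumpPos 7 (b + 5 + l)]"
    using sits_append(1)[OF placed] by (simp add: l_def)
  have rest: "sits P (b + 3) (code c (b + 3) @
      [Const 7 1, Add (8 * x) (8 * x) 7, Sub 7 0 (8 * x), JumpPos 7 (b + 3)])"
    using sits_append(2)[OF placed] by (simp add: numeral_3_eq_3)
  have body: "sits P (b + 3) (code c (b + 3))"
    by (rule sits_append(1)[OF rest])
  have tail: "sits P (b + 3 + l) [Const 7 1, Add (8 * x) (8 * x) 7, Sub 7 0 (8 * x), JumpPos 7 (b + 3)]"
    unfolding l_def by (rule sits_append(2)[OF rest])
  have enter: "reaches P b S 3 (b + 5 + l) (F 0)"
    unfolding reaches_def
  proof (intro allI impI)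
    fix s assume s: "represents s S \<and> pc s = b"
    define s' where "s' = s\<lparr>pc := b + 5 + l, mem := (mem s)(8 * x := 0, 7 := 1)\<rparr>"
    have "stepn P 3 s s'"
      using s sits_nth[OF head, of 0] sits_nth[OF head, of 1] sits_nth[OF head, of 2]
      by (simp add: numeral_3_eq_3 put_def s'_def)
    moreover have "represents s' (F 0)"
      by (rule represents_set_var[OF conjunct1[OF s], where x = x and k = 0])
         (use s in \<open>simp_all add: F_def s'_def represents_def var_cell\<close>)
    ultimately show "\<exists>s'. stepn P 3 s s' \<and> represents s' (F 0) \<and> pc s' = b + 5 + l"
      by (intro exI[of _ s']) (simp add: s'_def)
  qed
  \<comment> \<open>Register 7 receives \<open>n - i\<close>, which is positive exactly while rounds
    remain. The test is the point where entry and every round arrive.\<close>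
  have test: "reaches P (b + 5 + l) (F i) 2 (if i < n then b + 3 else b + 7 + l) (F i)" for i
    unfolding reaches_def
  proof (intro allI impI)
    fix s assume s: "represents s (F i) \<and> pc s = b + 5 + l"
    define s' where "s' = s\<lparr>pc := (if i < n then b + 3 else b + 7 + l), mem := (mem s)(7 := n - i)\<rparr>"
    have cells: "\<forall>y. mem s (8 * y) = var (F i) y"
      using s by (simp add: represents_def)
    have "mem s 0 = n" "mem s (8 * x) = i"
      using spec[OF cells, of 0] spec[OF cells, of x] F_var[of i] by simp_all
    moreover have eq: "b + 3 + l + 2 = pc s" "b + 3 + l + 3 = Suc (pc s)"
      using s by simp_all
    have "P ! (b + 3 + l + 2) = Sub 7 0 (8 * x)" "P ! (b + 3 + l + 3) = JumpPos 7 (b + 3)"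
      "b + 3 + l + 3 < length P"
      using sits_nth[OF tail, of 2] sits_nth[OF tail, of 3] by simp_all
    note this[unfolded eq]
    moreover have "Suc (Suc (pc s)) = b + 7 + l"
      using s by simp
    ultimately have "stepn P 2 s s'"
      by (simp add: numeral_2_eq_2 put_def s'_def)
    moreover have "represents s' (F i)"
      using s by (simp add: s'_def represents_def var_cell arr_cell)
    ultimately show "\<exists>s'. stepn P 2 s s' \<and> represents s' (F i) \<and> pc s' = (if i < n then b + 3 else b + 7 + l)"
      by (intro exI[of _ s']) (simp add: s'_def)
  qed
  have "reaches P (b + 3) (F i) (steps c n) (b + 3 + l) (sem c (F i))" for i
    using For.IH[OF body, of "F i"] For.prems F_var[of i] by (simp add: l_def)
  moreover have "reaches P (b + 3 + l) (sem c (F i)) 2 (b + 5 + l) (F (Suc i))" for i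
  proof -
    have "sits P (b + 3 + l) [Const 7 1, Add (8 * x) (8 * x) 7]"
      using sits_append(1)[of P "b + 3 + l" "[Const 7 1, Add (8 * x) (8 * x) 7]"] tail by simp
    moreover have "represents (fold exec [Const 7 1, Add (8 * x) (8 * x) 7] s) (F (Suc i))"
      if "represents s (sem c (F i))" for s
      by (rule represents_set_var[OF that, where x = x and k = "Suc (var (sem c (F i)) x)"])
         (use that in \<open>simp_all add: put_def F_Suc represents_def var_cell\<close>)
    ultimately have "reaches P (b + 3 + l) (sem c (F i)) (length [Const 7 1, Add (8 * x) (8 * x) 7])
        (b + 3 + l + length [Const 7 1, Add (8 * x) (8 * x) 7]) (F (Suc i))"
      by (intro reaches_straight) simp_all
    then show ?thesis
      by (simp add: numeral_2_eq_2 add.commute add.left_commute)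
  qed
  ultimately have round: "reaches P (b + 3) (F i) (steps c n + 2) (b + 5 + l) (F (Suc i))" for i
    by (rule reaches_trans)
  \<comment> \<open>\<open>d\<close> is the number of rounds still to run, so the induction goes
    backwards from the final, failing test.\<close>
  have loop: "reaches P (b + 5 + l) (F (n - d)) (d * (steps c n + 4) + 2) (b + 7 + l) (F n)" if "d \<le> n" for d
    using that
  proof (induction d)
    case 0
    then show ?case
      using test[of n] by (simp add: numeral_2_eq_2)
  next
    case (Suc d)
    have "reaches P (b + 5 + l) (F (n - Suc d)) 2 (b + 3) (F (n - Suc d))"
      using test[of "n - Suc d"] Suc.prems by simp
    moreover have "reaches P (b + 3) (F (n - Suc d)) (steps c n + 2) (b + 5 + l) (F (n - d))"
      using round[of "n - Suc d"] Suc.prems by (simp add: Suc_diff_Suc)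
    moreover have "reaches P (b + 5 + l) (F (n - d)) (d * (steps c n + 4) + 2) (b + 7 + l) (F n)"
      using Suc by simp
    ultimately have "reaches P (b + 5 + l) (F (n - Suc d)) (2 + ((steps c n + 2) + (d * (steps c n + 4) + 2)))
        (b + 7 + l) (F n)"
      by (rule reaches_trans[OF _ reaches_trans])
    moreover have "2 + ((steps c n + 2) + (d * (steps c n + 4) + 2)) = Suc d * (steps c n + 4) + 2"
      by simp
    ultimately show ?case
      by (simp only:)
  qed
  have "reaches P b S (3 + (n * (steps c n + 4) + 2)) (b + 7 + l) (F n)"
    using reaches_trans[OF enter, of "n * (steps c n + 4) + 2"] loop[of n] by simp
  moreover have "sem (For x c) S = F n"
    by (simp add: F_def n_def)
  moreover have "3 + (n * (steps c n + 4) + 2) = steps (For x c) (var S 0)"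
    by (simp add: n_def)
  moreover have "b + 7 + l = b + length (code (For x c) b)"
    by (simp add: l_def)
  ultimately show ?case
    by (simp only:)
qed

section \<open>From step counts to polynomial logarithmic cost\<close>

lemma bits_mono: "m \<le> n \<Longrightarrow> bits m \<le> bits n"
  by (simp add: bits_def floor_log_le_iff)

lemma bits_le: "n > 0 \<Longrightarrow> bits n \<le> n"
  using less_le_trans[OF less_exp floor_log_exp2_le[of n]] by (simp add: bits_def Suc_le_eq)

text \<open>Each instruction at most doubles the numbers in use, so their bit lengths are bounded by the running time.\<close>

lemma run_of_stepn:
  assumes "stepn P k s s'" "length P \<le> pc s'" "B > 0"
    and "\<And>j. mem s j \<le> B" "\<forall>x\<in>set (inp s). x \<le> B" "\<And>i c. Const i c \<in> set P \<Longrightarrow> c \<le> B"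
  shows "\<exists>t. run P s t s' \<and> t \<le> k * (2 * (k + bits B))"
  using assms
proof (induction k arbitrary: s B)
  case 0
  then show ?case
    by (auto intro: run.halt)
next
  case (Suc k)
  let ?i = "P ! pc s"
  have pc: "pc s < length P" and st: "stepn P k (exec ?i s) s'"
    using Suc.prems(1) by auto
  have const: "c \<le> B" if "?i = Const i c" for i c
    using Suc.prems(6) that nth_mem[OF pc] by metis
  have head: "input_head s \<le> B"
    using Suc.prems(5) by (auto simp: input_head_def split: list.split)
  have "mem (exec ?i s) j \<le> 2 * B" for j
    using Suc.prems(4)[of j] Suc.prems(4) add_mono[OF Suc.prems(4) Suc.prems(4)] const head
    by (cases ?i) (auto simp: put_def mult_2 intro: trans_le_add1 le_trans[OF diff_le_self])
  moreover have "x \<le> 2 * B" if "x \<in> set (inp (exec ?i s))" for x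
  proof -
    have "set (tl (inp s)) \<subseteq> set (inp s)"
      by (cases "inp s") auto
    then have "set (inp (exec ?i s)) \<subseteq> set (inp s)"
      by (cases ?i) (simp_all add: put_def)
    then show ?thesis
      using that Suc.prems(5) by fastforce
  qed
  moreover have "c \<le> 2 * B" if "Const i c \<in> set P" for i c
    using Suc.prems(6)[OF that] by simp
  \<comment> \<open>After one step the bound is \<open>2 * B\<close>, with one more bit, but one
    step fewer remains. Hence steps plus bits, and with it the bound on the cost of a single
    instruction, stays the same.\<close>
  ultimately obtain t where t: "run P (exec ?i s) t s'" "t \<le> k * (2 * (k + bits (2 * B)))"
    using Suc.IH[OF st Suc.prems(2), of "2 * B"] Suc.prems(3) by auto
  have "cost ?i s \<le> 2 * bits B"
    using Suc.prems(4) const head add_mono[OF bits_mono[OF Suc.prems(4)] bits_mono[OF Suc.prems(4)]]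
    by (cases ?i) (auto simp: mult_2 intro: trans_le_add1 bits_mono)
  moreover have "bits (2 * B) = Suc (bits B)"
    using Suc.prems(3) by (simp add: bits_def)
  ultimately have "cost ?i s + t \<le> Suc k * (2 * (Suc k + bits B))"
    using t(2) by (simp add: algebra_simps)
  then show ?case
    using run.step[OF pc t(1)] by blast
qed

text \<open>Allowing any \<open>m \<ge> n\<close> lets a bound in the number of vertices be
  evaluated at \<open>card V + card E\<close>.\<close>

definition poly_bounded :: "(nat \<Rightarrow> nat) \<Rightarrow> bool" where
  "poly_bounded f \<longleftrightarrow> (\<exists>q :: nat poly. \<forall>n m. n \<le> m \<longrightarrow> f n \<le> poly q m)"

lemma poly_bounded_const: "poly_bounded (\<lambda>n. c)"
  unfolding poly_bounded_def by (intro exI[of _ "[:c:]"]) simp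

lemma poly_bounded_id: "poly_bounded (\<lambda>n. n)"
  unfolding poly_bounded_def by (intro exI[of _ "[:0, 1:]"]) simp

lemma poly_bounded_add: "poly_bounded f \<Longrightarrow> poly_bounded g \<Longrightarrow> poly_bounded (\<lambda>n. f n + g n)"
  unfolding poly_bounded_def by (metis add_mono poly_add)

lemma poly_bounded_mult: "poly_bounded f \<Longrightarrow> poly_bounded g \<Longrightarrow> poly_bounded (\<lambda>n. f n * g n)"
  unfolding poly_bounded_def by (metis mult_le_mono poly_mult)

lemmas poly_bounded_intros = poly_bounded_const poly_bounded_id poly_bounded_add poly_bounded_mult

lemma poly_bounded_steps: "poly_bounded (steps c)"
  by (induction c) (auto simp: fun_eq_iff intro!: poly_bounded_intros)

text \<open>Needed for the printing loop, whose bound is the number of coefficients and not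
  \<open>n\<close>.\<close>

lemma steps_mono: "m \<le> n \<Longrightarrow> steps c m \<le> steps c n"
  by (induction c) (auto intro!: add_mono mult_mono)

section \<open>The program\<close>

text \<open>Variable 0 is the loop bound. \<open>rZero\<close> is never assigned and keeps its
  initial 0, so that adding it copies a variable.\<close>

abbreviation (input) "rLim \<equiv> 0 :: nat"
abbreviation (input) "rOne \<equiv> 1 :: nat"
abbreviation (input) "rZero \<equiv> 2 :: nat"
abbreviation (input) "rPos \<equiv> 3 :: nat"
abbreviation (input) "rRowU \<equiv> 4 :: nat"
abbreviation (input) "rRowV \<equiv> 5 :: nat"
abbreviation (input) "rU \<equiv> 6 :: nat"
abbreviation (input) "rV \<equiv> 7 :: nat"
abbreviation (input) "rW \<equiv> 8 :: nat"
abbreviation (input) "rCnt \<equiv> 9 :: nat"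
abbreviation (input) "rA \<equiv> 10 :: nat"
abbreviation (input) "rB \<equiv> 11 :: nat"

abbreviation (input) "aMat \<equiv> 1 :: nat"
abbreviation (input) "aHP \<equiv> 2 :: nat"
abbreviation (input) "aHQ \<equiv> 3 :: nat"
abbreviation (input) "aP \<equiv> 4 :: nat"
abbreviation (input) "aQ \<equiv> 5 :: nat"

text \<open>A running position replaces the product in the index of a matrix entry.\<close>

definition "read_matrix =
  For rU (For rV (Input rA ;; Update aMat rPos rA ;; Plus rPos rPos rOne))"

text \<open>
  Conditionals are avoided: with truncated subtraction, \<open>x + y - 1\<close> is the conjunction of two bits, and
  \<open>1 - (1 - (x - y))\<close> is the bit \<open>y < x\<close>.
\<close>

definition "count_common =
  Assign rCnt 0 ;;
  For rW (Plus rA rRowU rW ;; Fetch rA aMat rA ;; Plus rB rRowV rW ;; Fetch rB aMat rB ;;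
         Plus rA rA rB ;; Minus rA rA rOne ;; Plus rCnt rCnt rA)"

text \<open>The first line leaves in \<open>rA\<close> the bit \<open>v < u\<close> and in
  \<open>rB\<close> its negation. Subtracting \<open>v - u\<close> from the latter leaves 1 only if
  neither difference is positive, which is the bit for \<open>v = u\<close>.\<close>

definition "record_pair =
  Minus rA rU rV ;; Minus rB rOne rA ;; Minus rA rOne rB ;;
  Fetch rW aHQ rCnt ;; Plus rW rW rA ;; Update aHQ rCnt rW ;;
  Minus rA rV rU ;; Minus rB rB rA ;;
  Fetch rW aHP rCnt ;; Plus rW rW rB ;; Update aHP rCnt rW ;;
  Plus rRowV rRowV rLim"

definition "histograms =
  Assign rRowU 0 ;;
  For rU (Assign rRowV 0 ;; For rV (count_common ;; record_pair) ;; Plus rRowU rRowU rLim)"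

text \<open>
  Horner's scheme for \<open>\<Sum>d. h\<^sub>d (1 + X)\<^sup>d\<close>: \<open>shift_add\<close> replaces the polynomial \<open>p\<close> by
  \<open>(1 + X) p + c\<close>, where \<open>rCnt\<close> holds \<open>c\<close> first and then the previous coefficient of \<open>p\<close>.
\<close>

definition "shift_add p =
  For rV (Fetch rA p rV ;; Plus rB rA rCnt ;; Update p rV rB ;; Plus rCnt rA rZero)"

text \<open>Horner's scheme takes the highest entry first, so \<open>rW\<close> runs down from
  \<open>n\<close>.\<close>

definition "choose_sums h p =
  Plus rW rLim rZero ;;
  For rU (Minus rW rW rOne ;; Fetch rCnt h rW ;; shift_add p)"

definition "subtract_arrs =
  For rU (Fetch rA aP rU ;; Fetch rB aQ rU ;; Minus rA rA rB ;; Update aP rU rA)"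

text \<open>Small sets may lie in many neighborhoods, so the alternating sum is replaced for sizes
  0, 1 and 2. The array \<open>aQ\<close> is unchanged by the subtraction and its entry 0 is still
  the number of all pairs. For small \<open>n\<close> some of these entries lie beyond the printed
  ones.\<close>

definition "fix_low =
  Update aP rZero rOne ;;
  Fetch rA aHP rZero ;; Minus rA rLim rA ;; Update aP rOne rA ;;
  Fetch rA aQ rZero ;; Fetch rB aHQ rZero ;; Minus rA rA rB ;; Assign rB 2 ;; Update aP rB rA"

text \<open>
  The positive coefficients are exactly those up to the maximum degree, so their number is the length
  of the output.
\<close>

definition "count_positive =
  For rU (Fetch rA aP rU ;; Minus rA rOne rA ;; Minus rA rOne rA ;; Plus rCnt rCnt rA)"

text \<open>The last assignment turns the number of coefficients into the bound of the printing
  loop.\<close>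

definition "main =
  Assign rOne 1 ;; read_matrix ;; histograms ;; choose_sums aHP aP ;; choose_sums aHQ aQ ;;
  subtract_arrs ;; fix_low ;; Assign rCnt 0 ;; count_positive ;; Plus rLim rCnt rZero"

definition "print_coeffs = For rU (Fetch rA aP rU ;; Output rA)"

lemmas program_defs = read_matrix_def count_common_def record_pair_def histograms_def shift_add_def
  choose_sums_def subtract_arrs_def fix_low_def count_positive_def main_def print_coeffs_def

section \<open>Correctness of the single pieces\<close>

lemma read_matrix:
  assumes "var s rOne = 1" "var s rPos = 0" "length (source s) = var s rLim * var s rLim"
  shows "\<forall>k < var s rLim * var s rLim. arr (sem read_matrix s) aMat k = source s ! k"
proof -
  let ?n = "var s rLim"
  \<comment> \<open>Counting the entries read so far as one number serves both loops: the inner one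
    advances it by 1, the outer one by \<open>?n\<close>.\<close>
  define I where "I k t \<longleftrightarrow> var t rOne = 1 \<and> var t rPos = k \<and> source t = drop k (source s) \<and>
    (\<forall>j<k. arr t aMat j = source s ! j)" for k and t :: state
  have step: "I (Suc k) (incr rV (sem (Input rA ;; Update aMat rPos rA ;; Plus rPos rPos rOne) t))"
    if "I k t" "k < ?n * ?n" for k and t :: state
  proof -
    have next_entry: "drop k (source s) = source s ! k # drop (Suc k) (source s)"
      using that(2) assms(3) by (simp add: Cons_nth_drop_Suc)
    show ?thesis
      using that(1) by (auto simp: I_def less_Suc_eq next_entry)
  qed
  have index: "i * ?n + j < ?n * ?n" if "i < ?n" "j < ?n" for i j
  proof -
    have "i * ?n + j < Suc i * ?n"
      using that by simp
    also have "\<dots> \<le> ?n * ?n"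
      using that by (intro mult_le_mono) simp_all
    finally show ?thesis .
  qed
  have row: "I (i * ?n + ?n) (sem (For rV (Input rA ;; Update aMat rPos rA ;; Plus rPos rPos rOne)) t)"
    if t: "I (i * ?n) t" "i < ?n" "var t rLim = ?n" for i and t :: state
  proof -
    have "I (i * ?n + var t 0) (sem (For rV (Input rA ;; Update aMat rPos rA ;; Plus rPos rPos rOne)) t)"
    proof (rule For_invariant)
      show "I (i * ?n + 0) (set_var rV 0 t)"
        using t by (simp add: I_def)
    next
      fix j and t' :: state
      assume "j < var t 0" "I (i * ?n + j) t'"
      then show "I (i * ?n + Suc j) (incr rV (sem (Input rA ;; Update aMat rPos rA ;; Plus rPos rPos rOne) t'))"
        using step index t by simp
    qed simp
    then show ?thesis
      using t by simp
  qed
  have "I (?n * ?n) (sem read_matrix s)"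
    unfolding read_matrix_def
  proof (rule For_invariant[where I = "\<lambda>i. I (i * ?n)"])
    show "I (0 * ?n) (set_var rU 0 s)"
      using assms by (simp add: I_def)
  next
    fix i and t :: state
    assume "i < ?n" "I (i * ?n) t"
      and frame: "\<And>y. y \<notin> written_vars (For rU (For rV (Input rA ;; Update aMat rPos rA ;; Plus rPos rPos rOne))) \<Longrightarrow>
        var t y = var s y"
    moreover have "var t rLim = ?n"
      by (rule frame) simp
    ultimately have "I (i * ?n + ?n) (sem (For rV (Input rA ;; Update aMat rPos rA ;; Plus rPos rPos rOne)) t)"
      by (intro row)
    then show "I (Suc i * ?n) (incr rU (sem (For rV (Input rA ;; Update aMat rPos rA ;; Plus rPos rPos rOne)) t))"
      by (simp add: I_def add.commute del: sem.simps)
  qed simp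
  then show ?thesis
    by (simp add: I_def)
qed

lemma count_common_written: "written_vars count_common = {rCnt, rW, rA, rB}" "written_arrs count_common = {}"
  by (auto simp: count_common_def)

lemma count_common:
  assumes "var s rOne = 1"
  shows "var (sem count_common s) rCnt =
    (\<Sum>j<var s rLim. arr s aMat (var s rRowU + j) + arr s aMat (var s rRowV + j) - 1)"
proof -
  define f where "f j = arr s aMat (var s rRowU + j) + arr s aMat (var s rRowV + j) - 1" for j
  let ?body = "Plus rA rRowU rW ;; Fetch rA aMat rA ;; Plus rB rRowV rW ;; Fetch rB aMat rB ;;
         Plus rA rA rB ;; Minus rA rA rOne ;; Plus rCnt rCnt rA"
  let ?s = "set_var rCnt 0 s"
  have "var (sem (For rW ?body) ?s) rCnt = (\<Sum>j<var ?s 0. f j)"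
  proof (rule For_invariant)
    fix i and t :: state
    assume "var t rCnt = (\<Sum>j<i. f j)" "var t rW = i"
      and frame: "\<And>y. y \<notin> written_vars (For rW ?body) \<Longrightarrow> var t y = var ?s y"
        "\<And>c. c \<notin> written_arrs ?body \<Longrightarrow> arr t c = arr ?s c"
    moreover have "var t rOne = 1" "var t rRowU = var s rRowU" "var t rRowV = var s rRowV" "arr t = arr s"
      using frame(1)[of rOne] frame(1)[of rRowU] frame(1)[of rRowV] frame(2) assms by (simp_all add: fun_eq_iff)
    ultimately show "var (incr rW (sem ?body t)) rCnt = (\<Sum>j<Suc i. f j)"
      by (simp add: f_def)
  qed simp_all
  then show ?thesis
    by (simp add: count_common_def f_def del: sem.simps(9))
qed


lemma record_pair:
  assumes "var s rOne = 1"
  shows "arr (sem record_pair s) aHP = (arr s aHP)(var s rCnt := arr s aHP (var s rCnt) + of_bool (var s rV = var s rU))"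
    and "arr (sem record_pair s) aHQ = (arr s aHQ)(var s rCnt := arr s aHQ (var s rCnt) + of_bool (var s rV < var s rU))"
    and "var (sem record_pair s) rRowV = var s rRowV + var s rLim"
  using assms by (auto simp: record_pair_def fun_eq_iff)

lemma record_pair_written:
  "written_vars record_pair = {rA, rB, rW, rRowV}" "written_arrs record_pair = {aHP, aHQ}"
  by (auto simp: record_pair_def)

text \<open>What the machine code computes from arbitrary rows; for 0/1 rows it is the number of
  common ones.\<close>

definition overlap :: "nat \<Rightarrow> (nat \<Rightarrow> nat \<Rightarrow> nat) \<Rightarrow> nat \<Rightarrow> nat \<Rightarrow> nat" where
  "overlap n M i j = (\<Sum>k<n. M i k + M j k - 1)"

lemma histogram_row:
  fixes M :: "nat \<Rightarrow> nat \<Rightarrow> nat"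
  assumes one: "var s rOne = 1" and n: "var s rLim = n" and i: "var s rU = i" "i < n"
    and rows: "var s rRowU = i * n" "var s rRowV = 0"
    and mat: "\<And>j k. j < n \<Longrightarrow> k < n \<Longrightarrow> arr s aMat (j * n + k) = M j k"
  defines "s' \<equiv> sem (For rV (count_common ;; record_pair)) s"
  shows "arr s' aHP d = arr s aHP d + (\<Sum>j<n. of_bool (j = i \<and> overlap n M i j = d))"
    and "arr s' aHQ d = arr s aHQ d + (\<Sum>j<n. of_bool (j < i \<and> overlap n M i j = d))"
proof -
  let ?body = "count_common ;; record_pair"
  define I where "I j t \<longleftrightarrow> var t rRowV = j * n \<and>
    (\<forall>d. arr t aHP d = arr s aHP d + (\<Sum>j<j. of_bool (j = i \<and> overlap n M i j = d))) \<and>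
    (\<forall>d. arr t aHQ d = arr s aHQ d + (\<Sum>j<j. of_bool (j < i \<and> overlap n M i j = d)))" for j and t :: state
  have "I (var s 0) (sem (For rV ?body) s)"
  proof (rule For_invariant)
    show "well_formed (For rV ?body)"
      by (simp add: count_common_def record_pair_def)
    show "I 0 (set_var rV 0 s)"
      using rows by (simp add: I_def)
  next
    fix j and t :: state
    assume j: "j < var s 0" and I: "I j t" and v: "var t rV = j"
      and frame: "\<And>y. y \<notin> written_vars (For rV ?body) \<Longrightarrow> var t y = var s y"
        "\<And>c. c \<notin> written_arrs ?body \<Longrightarrow> arr t c = arr s c"
    have t: "var t rOne = 1" "var t rLim = n" "var t rU = i" "var t rRowU = i * n" "arr t aMat = arr s aMat"
      using frame(1)[of rOne] frame(1)[of rLim] frame(1)[of rU] frame(1)[of rRowU] frame(2)[of aMat] one n i rows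
      by (simp_all add: count_common_written record_pair_written)
    define t1 where "t1 = sem count_common t"
    have t1: "var t1 rOne = 1" "var t1 rLim = n" "var t1 rU = i" "var t1 rV = j" "var t1 rRowV = j * n"
      "arr t1 = arr t"
      using t v I by (simp_all add: t1_def sem_var sem_arr count_common_written I_def fun_eq_iff)
    have "var t1 rCnt = (\<Sum>k<n. arr t aMat (i * n + k) + arr t aMat (j * n + k) - 1)"
      using count_common[of t] t I by (simp add: t1_def I_def)
    also have "\<dots> = overlap n M i j"
      unfolding overlap_def using mat i j n t by (intro sum.cong) simp_all
    finally have cnt: "var t1 rCnt = overlap n M i j" .
    have "I (Suc j) (sem record_pair t1)"
      using I record_pair[of t1] t1 cnt by (auto simp: I_def)
    then show "I (Suc j) (incr rV (sem ?body t))"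
      by (simp add: I_def t1_def)
  qed
  then show "arr s' aHP d = arr s aHP d + (\<Sum>j<n. of_bool (j = i \<and> overlap n M i j = d))"
    "arr s' aHQ d = arr s aHQ d + (\<Sum>j<n. of_bool (j < i \<and> overlap n M i j = d))"
    using n by (simp_all add: I_def s'_def)
qed

lemma histograms:
  fixes M :: "nat \<Rightarrow> nat \<Rightarrow> nat"
  assumes one: "var s rOne = 1" and n: "var s rLim = n"
    and mat: "\<And>j k. j < n \<Longrightarrow> k < n \<Longrightarrow> arr s aMat (j * n + k) = M j k"
    and init: "arr s aHP = (\<lambda>_. 0)" "arr s aHQ = (\<lambda>_. 0)"
  shows "arr (sem histograms s) aHP d = (\<Sum>i<n. \<Sum>j<n. of_bool (j = i \<and> overlap n M i j = d))"
    and "arr (sem histograms s) aHQ d = (\<Sum>i<n. \<Sum>j<n. of_bool (j < i \<and> overlap n M i j = d))"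
proof -
  let ?row = "For rV (count_common ;; record_pair)"
  let ?body = "Assign rRowV 0 ;; ?row ;; Plus rRowU rRowU rLim"
  let ?s = "set_var rRowU 0 s"
  have written: "written_vars ?row = {rA, rB, rW, rRowV, rCnt, rV}" "written_arrs ?row = {aHP, aHQ}"
    by (auto simp: count_common_written record_pair_written)
  define I where "I i t \<longleftrightarrow> var t rRowU = i * n \<and>
    (\<forall>d. arr t aHP d = (\<Sum>i<i. \<Sum>j<n. of_bool (j = i \<and> overlap n M i j = d))) \<and>
    (\<forall>d. arr t aHQ d = (\<Sum>i<i. \<Sum>j<n. of_bool (j < i \<and> overlap n M i j = d)))" for i and t :: state
  have "I (var ?s 0) (sem (For rU ?body) ?s)"
  proof (rule For_invariant)
    show "well_formed (For rU ?body)"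
      by (simp add: count_common_def record_pair_def)
    show "I 0 (set_var rU 0 ?s)"
      using init by (simp add: I_def)
  next
    fix i and t :: state
    assume i: "i < var ?s 0" and I: "I i t" and u: "var t rU = i"
      and frame: "\<And>y. y \<notin> written_vars (For rU ?body) \<Longrightarrow> var t y = var ?s y"
        "\<And>c. c \<notin> written_arrs ?body \<Longrightarrow> arr t c = arr ?s c"
    have t: "var t rOne = 1" "var t rLim = n" "arr t aMat = arr s aMat"
      using frame(1)[of rOne] frame(1)[of rLim] frame(2)[of aMat] one n
      by (simp_all add: count_common_written record_pair_written)
    define t1 where "t1 = sem ?row (set_var rRowV 0 t)"
    have t1: "var t1 rLim = n" "var t1 rRowU = i * n"
      using t I by (simp_all add: t1_def sem_var written I_def del: sem.simps(9) written_vars.simps(9))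
    have "arr t1 aHP d = arr t aHP d + (\<Sum>j<n. of_bool (j = i \<and> overlap n M i j = d))"
      "arr t1 aHQ d = arr t aHQ d + (\<Sum>j<n. of_bool (j < i \<and> overlap n M i j = d))" for d
      using histogram_row[of "set_var rRowV 0 t" n i M d] t u i n I mat
      by (simp_all add: t1_def I_def del: sem.simps(9))
    then have "I (Suc i) (sem (Plus rRowU rRowU rLim) t1)"
      using I t1 by (simp add: I_def)
    then show "I (Suc i) (incr rU (sem ?body t))"
      by (simp add: I_def t1_def del: sem.simps(9))
  qed
  then show "arr (sem histograms s) aHP d = (\<Sum>i<n. \<Sum>j<n. of_bool (j = i \<and> overlap n M i j = d))"
    "arr (sem histograms s) aHQ d = (\<Sum>i<n. \<Sum>j<n. of_bool (j < i \<and> overlap n M i j = d))"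
    using n by (simp_all add: I_def histograms_def del: sem.simps(9))
qed

lemma shift_add:
  assumes "var s rZero = 0" "1 \<le> p" "p \<le> 6"
  shows "arr (sem (shift_add p) s) p k = (if k < var s rLim
    then arr s p k + (if k = 0 then var s rCnt else arr s p (k - 1)) else arr s p k)"
proof -
  let ?body = "Fetch rA p rV ;; Plus rB rA rCnt ;; Update p rV rB ;; Plus rCnt rA rZero"
  define new where "new k = arr s p k + (if k = 0 then var s rCnt else arr s p (k - 1))" for k
  define I where "I i t \<longleftrightarrow> (\<forall>k. arr t p k = (if k < i then new k else arr s p k)) \<and>
    var t rCnt = (if i = 0 then var s rCnt else arr s p (i - 1))" for i and t :: state
  have "I (var s 0) (sem (For rV ?body) s)"
  proof (rule For_invariant)
    fix i and t :: state
    assume "I i t" "var t rV = i"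
      and frame: "\<And>y. y \<notin> written_vars (For rV ?body) \<Longrightarrow> var t y = var s y"
    moreover have "var t rZero = 0"
      using frame[of rZero] assms by simp
    ultimately show "I (Suc i) (incr rV (sem ?body t))"
      by (auto simp: I_def new_def less_Suc_eq)
  qed (use assms in \<open>simp_all add: I_def\<close>)
  then show ?thesis
    by (simp add: I_def shift_add_def new_def)
qed

lemma choose_sums:
  assumes zero: "var s rZero = 0" and one: "var s rOne = 1" and n: "var s rLim = n"
    and p: "1 \<le> p" "p \<le> 6" "1 \<le> h" "h \<le> 6" "h \<noteq> p" and init: "arr s p = (\<lambda>_. 0)" and "k < n"
  shows "arr (sem (choose_sums h p) s) p k = choose_sum n (arr s h) k"
proof -
  let ?body = "Minus rW rW rOne ;; Fetch rCnt h rW ;; shift_add p"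
  let ?s = "set_var rW n s"
  have written: "written_vars (shift_add p) = {rA, rB, rCnt, rV}" "written_arrs (shift_add p) = {p}"
    by (auto simp: shift_add_def)
  \<comment> \<open>\<open>f m\<close> lists the coefficients of \<Sum>d\<ge>m
    \<open>h d (1 + X)^(d - m)\<close>, the intermediate polynomial of Horner's scheme.\<close>
  define f where "f m k = (\<Sum>d\<in>{m..<n}. arr s h d * ((d - m) choose k))" for m k
  define I where "I i t \<longleftrightarrow> var t rW = n - i \<and> (\<forall>k<n. arr t p k = f (n - i) k)" for i and t :: state
  \<comment> \<open>Multiplication by \<open>1 + X\<close> followed by adding \<open>h m\<close>,
    read off coefficientwise; for positive \<open>k\<close> it is Pascal's rule.\<close>
  have f_rec: "f m k = f (Suc m) k + (if k = 0 then arr s h m else f (Suc m) (k - 1))" if "m < n" for m k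
  proof (cases k)
    case 0
    then show ?thesis
      using that by (simp add: f_def sum.atLeast_Suc_lessThan)
  next
    case (Suc l)
    have "f m k = (\<Sum>d\<in>{Suc m..<n}. arr s h d * ((d - m) choose Suc l))"
      using that Suc by (simp add: f_def sum.atLeast_Suc_lessThan)
    also have "\<dots> = (\<Sum>d\<in>{Suc m..<n}. arr s h d * ((d - Suc m) choose Suc l) + arr s h d * ((d - Suc m) choose l))"
    proof (intro sum.cong refl)
      fix d assume "d \<in> {Suc m..<n}"
      then have "d - m = Suc (d - Suc m)"
        by (metis Suc_diff_Suc Suc_le_lessD atLeastLessThan_iff)
      then show "arr s h d * ((d - m) choose Suc l) =
          arr s h d * ((d - Suc m) choose Suc l) + arr s h d * ((d - Suc m) choose l)"
        by (simp add: algebra_simps)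
    qed
    finally show ?thesis
      using Suc by (simp add: f_def sum.distrib)
  qed
  have "I (var ?s 0) (sem (For rU ?body) ?s)"
  proof (rule For_invariant)
    show "well_formed (For rU ?body)"
      using p by (simp add: shift_add_def)
    show "I 0 (set_var rU 0 ?s)"
      using init by (simp add: I_def f_def)
  next
    fix i and t :: state
    assume i: "i < var ?s 0" and I: "I i t"
      and frame: "\<And>y. y \<notin> written_vars (For rU ?body) \<Longrightarrow> var t y = var ?s y"
        "\<And>c. c \<notin> written_arrs ?body \<Longrightarrow> arr t c = arr ?s c"
    have t: "var t rOne = 1" "var t rLim = n" "var t rZero = 0" "arr t h = arr s h"
      using frame(1)[of rOne] frame(1)[of rLim] frame(1)[of rZero] frame(2)[of h] one n zero p
      by (simp_all add: written)
    have m: "n - i = Suc (n - Suc i)"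
      using i n by simp
    define t1 where "t1 = sem (Minus rW rW rOne ;; Fetch rCnt h rW) t"
    have t1: "var t1 rLim = n" "var t1 rZero = 0" "var t1 rW = n - Suc i"
        "var t1 rCnt = arr s h (n - Suc i)" "arr t1 p = arr t p"
      using t I m by (simp_all add: t1_def I_def)
    have "arr (sem (shift_add p) t1) p k = f (n - Suc i) k" if "k < n" for k
    proof -
      have "arr t p k = f (Suc (n - Suc i)) k" "arr t p (k - 1) = f (Suc (n - Suc i)) (k - 1)"
        using I that m by (simp_all add: I_def less_imp_diff_less)
      then show ?thesis
        using shift_add[OF t1(2) p(1,2), of k] that t1 f_rec[of "n - Suc i" k] i n by simp
    qed
    then have "I (Suc i) (sem (shift_add p) t1)"
      using t1 by (simp add: I_def sem_var written)
    then show "I (Suc i) (incr rU (sem ?body t))"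
      by (simp add: I_def t1_def)
  qed
  then have "arr (sem (For rU ?body) ?s) p k = f 0 k"
    using n \<open>k < n\<close> by (simp add: I_def del: sem.simps(9))
  then show ?thesis
    using zero n by (simp add: choose_sums_def f_def choose_sum_def atLeast0LessThan del: sem.simps(9))
qed

lemma subtract_arrs:
  "arr (sem subtract_arrs s) aP k = (if k < var s rLim then arr s aP k - arr s aQ k else arr s aP k)"
proof -
  let ?body = "Fetch rA aP rU ;; Fetch rB aQ rU ;; Minus rA rA rB ;; Update aP rU rA"
  have "\<forall>k. arr (sem (For rU ?body) s) aP k = (if k < var s 0 then arr s aP k - arr s aQ k else arr s aP k)"
  proof (rule For_invariant)
    fix i and t :: state
    assume "\<forall>k. arr t aP k = (if k < i then arr s aP k - arr s aQ k else arr s aP k)" "var t rU = i"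
      and frame: "\<And>c. c \<notin> written_arrs ?body \<Longrightarrow> arr t c = arr s c"
    moreover have "arr t aQ = arr s aQ"
      using frame[of aQ] by simp
    ultimately show "\<forall>k. arr (incr rU (sem ?body t)) aP k = (if k < Suc i then arr s aP k - arr s aQ k else arr s aP k)"
      by (auto simp: less_Suc_eq)
  qed simp_all
  then show ?thesis
    by (simp add: subtract_arrs_def del: sem.simps(9))
qed

lemma fix_low:
  assumes "var s rOne = 1" "var s rZero = 0"
  shows "arr (sem fix_low s) aP = (arr s aP)
    (0 := 1, 1 := var s rLim - arr s aHP 0, 2 := arr s aQ 0 - arr s aHQ 0)"
  using assms by (simp add: fix_low_def)

lemma count_positive:
  assumes "var s rOne = 1" "var s rCnt = 0"
  shows "var (sem count_positive s) rCnt = card {k. k < var s rLim \<and> arr s aP k \<noteq> 0}"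
proof -
  let ?body = "Fetch rA aP rU ;; Minus rA rOne rA ;; Minus rA rOne rA ;; Plus rCnt rCnt rA"
  have "var (sem (For rU ?body) s) rCnt = (\<Sum>k<var s 0. of_bool (arr s aP k \<noteq> 0))"
  proof (rule For_invariant)
    fix i and t :: state
    assume "var t rCnt = (\<Sum>k<i. of_bool (arr s aP k \<noteq> 0))" "var t rU = i"
      and frame: "\<And>y. y \<notin> written_vars (For rU ?body) \<Longrightarrow> var t y = var s y"
        "\<And>c. c \<notin> written_arrs ?body \<Longrightarrow> arr t c = arr s c"
    moreover have "var t rOne = 1" "arr t aP = arr s aP"
      using frame(1)[of rOne] frame(2)[of aP] assms by simp_all
    ultimately show "var (incr rU (sem ?body t)) rCnt = (\<Sum>k<Suc i. of_bool (arr s aP k \<noteq> 0))"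
      by simp
  qed (use assms in simp_all)
  then show ?thesis
    by (simp add: count_positive_def sum_of_bool_eq Int_def del: sem.simps(9))
qed

lemma print_coeffs:
  "result (sem print_coeffs s) = result s @ map (arr s aP) [0..<var s rLim]"
proof -
  let ?body = "Fetch rA aP rU ;; Output rA"
  have "result (sem (For rU ?body) s) = result s @ map (arr s aP) [0..<var s 0]"
  proof (rule For_invariant)
    fix i and t :: state
    assume "result t = result s @ map (arr s aP) [0..<i]" "var t rU = i"
      and frame: "\<And>c. c \<notin> written_arrs ?body \<Longrightarrow> arr t c = arr s c"
    moreover have "arr t aP = arr s aP"
      using frame[of aP] by simp
    ultimately show "result (incr rU (sem ?body t)) = result s @ map (arr s aP) [0..<Suc i]"
      by simp
  qed simp_all
  then show ?thesis
    by (simp add: print_coeffs_def del: sem.simps(9))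
qed

section \<open>Assembling the pieces\<close>

lemma nth_concat_uniform:
  assumes "\<forall>ys\<in>set xss. length ys = m" "i < length xss" "j < m"
  shows "concat xss ! (i * m + j) = xss ! i ! j"
  using assms
proof (induction xss arbitrary: i)
  case (Cons ys xss)
  show ?case
  proof (cases i)
    case 0
    with Cons.prems show ?thesis
      by (simp add: nth_append)
  next
    case (Suc l)
    with Cons show ?thesis
      by (simp add: nth_append add.assoc)
  qed
qed simp

lemma read_matrix_written: "written_vars read_matrix = {rA, rPos, rU, rV}" "written_arrs read_matrix = {aMat}"
  by (auto simp: read_matrix_def)

lemma histograms_written:
  "written_vars histograms = {rRowU, rRowV, rU, rV, rW, rCnt, rA, rB}" "written_arrs histograms = {aHP, aHQ}"
  by (auto simp: histograms_def count_common_written record_pair_written)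

lemma choose_sums_written:
  "written_vars (choose_sums h p) = {rU, rV, rW, rCnt, rA, rB}" "written_arrs (choose_sums h p) = {p}"
  by (auto simp: choose_sums_def shift_add_def)

lemma subtract_arrs_written: "written_vars subtract_arrs = {rU, rA, rB}" "written_arrs subtract_arrs = {aP}"
  by (auto simp: subtract_arrs_def)

lemma fix_low_written: "written_vars fix_low = {rA, rB}" "written_arrs fix_low = {aP}"
  by (auto simp: fix_low_def)

lemma count_positive_written: "written_vars count_positive = {rU, rCnt, rA}" "written_arrs count_positive = {}"
  by (auto simp: count_positive_def)

lemmas written = read_matrix_written histograms_written choose_sums_written subtract_arrs_written
  fix_low_written count_positive_written

context listed_graph
begin

lemma coeff_eq_nbhd_coeff:
  assumes "planar V E" and "n > 0"
  shows "coeff (nbhd_poly V E) k = nbhd_coeff E vs k"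
proof -
  consider "k = 0" | "k = 1" | "k = 2" | "k \<ge> 3"
    by linarith
  then show ?thesis
  proof cases
    case 4
    have "coeff (nbhd_poly V E) k = choose_sum n (codeg_hist E vs (\<lambda>u v. v = u)) k -
        choose_sum n (codeg_hist E vs (\<lambda>u v. v < u)) k"
      by (intro coeff_ge_3 4) (rule planar_no_K33[OF simple assms(1)])
    then show ?thesis
      using 4 by (simp add: nbhd_coeff_def Let_def)
  qed (use coeff_0[OF \<open>n > 0\<close>] coeff_1 coeff_2 in \<open>simp_all add: nbhd_coeff_def Let_def\<close>)
qed

definition adjacency :: "nat \<Rightarrow> nat \<Rightarrow> nat" where
  "adjacency i j = of_bool (j \<in> N i)"

lemma overlap_adjacency:
  "overlap n adjacency i j = common_nbrs E vs i j"
proof -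
  have "overlap n adjacency i j = (\<Sum>k<n. of_bool (k \<in> N i \<inter> N j))"
    unfolding overlap_def adjacency_def by (intro sum.cong refl) auto
  also have "\<dots> = card ({..<n} \<inter> (N i \<inter> N j))"
    by (simp add: sum_of_bool_eq Int_def conj_commute)
  also have "{..<n} \<inter> (N i \<inter> N j) = N i \<inter> N j"
    by (auto simp: nbrs_def)
  finally show ?thesis
    by (simp add: common_nbrs_def)
qed

lemma main_correct:
  assumes init: "var s = (\<lambda>_. 0)(rLim := n)" "arr s = (\<lambda>_ _. 0)" "result s = []"
    and src: "source s = tl (encode_graph vs E)"
  defines "s' \<equiv> sem main s"
  shows "\<forall>k<n. arr s' aP k = nbhd_coeff E vs k"
    and "var s' rLim = card {k. k < n \<and> nbhd_coeff E vs k \<noteq> 0}"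
    and "result s' = []"
proof -
  let ?hp = "codeg_hist E vs (\<lambda>u v. v = u)" and ?hq = "codeg_hist E vs (\<lambda>u v. v < u)"
  define s0 where "s0 = sem (Assign rOne 1) s"
  define s1 where "s1 = sem read_matrix s0"
  define s2 where "s2 = sem histograms s1"
  define s3 where "s3 = sem (choose_sums aHP aP) s2"
  define s4 where "s4 = sem (choose_sums aHQ aQ) s3"
  define s5 where "s5 = sem subtract_arrs s4"
  define s6 where "s6 = sem fix_low s5"
  define s7 where "s7 = sem (Assign rCnt 0) s6"
  define s8 where "s8 = sem count_positive s7"
  have s': "s' = sem (Plus rLim rCnt rZero) s8"
    by (simp add: s'_def main_def s8_def s7_def s6_def s5_def s4_def s3_def s2_def s1_def s0_def)
  have fixed: "var t rOne = 1 \<and> var t rZero = 0 \<and> var t rLim = n" if "t \<in> {s0, s1, s2, s3, s4, s5, s6, s7, s8}" for t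
    using that init unfolding s8_def s7_def s6_def s5_def s4_def s3_def s2_def s1_def s0_def
    by (auto simp: sem_var written)
  define rows where "rows = map (\<lambda>x. map (\<lambda>y. if {x, y} \<in> E then 1 else 0 :: nat) vs) vs"
  have src_rows: "source s0 = concat rows"
    using src by (simp add: s0_def encode_graph_def rows_def)
  have row_lengths: "\<forall>ys\<in>set rows. length ys = n" "length rows = n"
    by (auto simp: rows_def)
  have "length (concat rows) = n * n"
    by (simp add: length_concat rows_def comp_def sum_list_triv)
  then have "\<forall>k < n * n. arr s1 aMat k = source s0 ! k"
    using read_matrix[of s0] fixed[of s0] init src_rows by (simp add: s1_def) (simp add: s0_def)
  moreover have "i * n + j < n * n" if "i < n" "j < n" for i j
  proof -
    have "i * n + j < Suc i * n"
      using that by simp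
    also have "\<dots> \<le> n * n"
      using that by (intro mult_le_mono) simp_all
    finally show ?thesis .
  qed
  ultimately have mat: "arr s1 aMat (i * n + j) = adjacency i j" if "i < n" "j < n" for i j
    using that nth_concat_uniform[OF row_lengths(1), of i j] row_lengths(2)
    by (simp add: src_rows) (simp add: rows_def adjacency_def nbrs_def)
  \<comment> \<open>Histograms and Horner's scheme both rely on arrays that start at zero.\<close>
  have arr1: "arr s1 c = (\<lambda>_. 0)" if "c \<noteq> aMat" for c
    using init that by (simp add: s1_def s0_def sem_arr written)
  have hist: "arr s2 aHP = ?hp" "arr s2 aHQ = ?hq"
    using histograms[of s1 n adjacency] fixed[of s1] mat arr1
    by (auto simp: s2_def codeg_hist_def overlap_adjacency fun_eq_iff)
  have arr2: "arr s2 aP = (\<lambda>_. 0)" "arr s2 aQ = (\<lambda>_. 0)"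
    using arr1 by (simp_all add: s2_def sem_arr written)
  have sum_P: "arr s3 aP k = choose_sum n ?hp k" if "k < n" for k
    using choose_sums[of s2 n aP aHP k] fixed[of s2] that arr2 hist by (simp add: s3_def)
  have arr3: "arr s3 c = arr s2 c" if "c \<noteq> aP" for c
    using that by (simp add: s3_def sem_arr written)
  have sum_Q: "arr s4 aQ k = choose_sum n ?hq k" if "k < n" for k
    using choose_sums[of s3 n aQ aHQ k] fixed[of s3] that arr2 arr3 hist by (simp add: s4_def)
  have arr4: "arr s4 c = arr s3 c" if "c \<noteq> aQ" for c
    using that by (simp add: s4_def sem_arr written)
  have arr5: "arr s5 c = arr s4 c" if "c \<noteq> aP" for c
    using that by (simp add: s5_def sem_arr written)
  have diff: "arr s5 aP k = choose_sum n ?hp k - choose_sum n ?hq k" if "k < n" for k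
    using subtract_arrs[of s4 k] fixed[of s4] that sum_P sum_Q arr4 by (simp add: s5_def)
  have low: "arr s6 aP = (arr s5 aP)(0 := 1, 1 := n - ?hp 0, 2 := arr s4 aQ 0 - ?hq 0)"
    using fix_low[of s5] fixed[of s5] arr5 arr4 arr3 hist by (simp add: s6_def)
  have P6: "arr s6 aP k = nbhd_coeff E vs k" if "k < n" for k
  proof -
    \<comment> \<open>\<open>k < n\<close> gives \<open>0 < n\<close>, so entry 0 is among the
      computed ones.\<close>
    have "arr s4 aQ 0 = choose_sum n ?hq 0"
      using that by (intro sum_Q) auto
    then show ?thesis
      using diff[OF that] by (simp add: low nbhd_coeff_def Let_def)
  qed
  have P8: "arr s8 aP = arr s6 aP" "arr s7 aP = arr s6 aP"
    by (simp_all add: s8_def s7_def sem_arr written)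
  then show "\<forall>k<n. arr s' aP k = nbhd_coeff E vs k"
    using P6 by (simp add: s')
  have "var s8 rCnt = card {k. k < n \<and> arr s6 aP k \<noteq> 0}"
    using count_positive[of s7] fixed[of s7] P8(2) by (simp add: s8_def) (simp add: s7_def)
  also have "{k. k < n \<and> arr s6 aP k \<noteq> 0} = {k. k < n \<and> nbhd_coeff E vs k \<noteq> 0}"
    using P6 by auto
  finally show "var s' rLim = card {k. k < n \<and> nbhd_coeff E vs k \<noteq> 0}"
    using fixed[of s8] by (simp add: s')
  show "result s' = []"
    unfolding s'_def by (subst sem_result) (simp_all add: program_defs init)
qed

text \<open>All nonzero coefficients occur below \<open>n\<close>, so counting there finds the
  length. The restriction matters for the graph without vertices, where \<open>nbhd_coeff\<close>
  still gives 1 at 0 but the polynomial is 0.\<close>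

lemma coeffs_nbhd_poly:
  assumes "planar V E"
  shows "coeffs (nbhd_poly V E) = map (nbhd_coeff E vs) [0..<card {k. k < n \<and> nbhd_coeff E vs k \<noteq> 0}]"
proof -
  obtain D where D: "D \<le> n" "\<And>k. coeff (nbhd_poly V E) k \<noteq> 0 \<longleftrightarrow> k < D"
    using coeff_pos_iff by blast
  have eq: "coeff (nbhd_poly V E) k = nbhd_coeff E vs k" if "k < n" for k
    using that by (intro coeff_eq_nbhd_coeff assms) auto
  have "nbhd_coeff E vs k \<noteq> 0 \<longleftrightarrow> k < D" if "k < n" for k
    using D(2)[of k] eq[OF that] by simp
  then have "{k. k < n \<and> nbhd_coeff E vs k \<noteq> 0} = {..<D}"
    using D(1) by auto
  moreover have "coeffs (nbhd_poly V E) = map (coeff (nbhd_poly V E)) [0..<D]"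
    by (rule coeffs_eq_map_coeff) (rule D(2))
  ultimately show ?thesis
    using D(1) eq by simp
qed

end

text \<open>The pieces are joined as machine code and not by \<open>;;\<close>, because the first
  two change the loop bound, which \<open>well_formed\<close> forbids on the left of
  \<open>;;\<close>.\<close>

definition nbhd_program :: "instr list" where
  "nbhd_program = (let c1 = code main 1; c2 = code print_coeffs (1 + length c1) in code (Input rLim) 0 @ c1 @ c2)"

definition program_steps :: "nat \<Rightarrow> nat" where
  "program_steps n = 1 + steps main n + steps print_coeffs n"

lemma well_formed_main: "well_formed main"
  by (simp add: program_defs)

lemma well_formed_print_coeffs: "well_formed print_coeffs"
  by (simp add: program_defs)

lemma nbhd_program_correct:
  fixes vs :: "'a list"
  assumes "simple_graph V E" "planar V E" "distinct vs" "set vs = V"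
  shows "\<exists>k s'. k \<le> program_steps (length vs) \<and>
    stepn nbhd_program k \<lparr>pc = 0, mem = (\<lambda>_. 0), inp = encode_graph vs E, out = []\<rparr> s' \<and>
    pc s' \<ge> length nbhd_program \<and> out s' = coeffs (nbhd_poly V E)"
proof -
  interpret listed_graph V E vs
    using assms by unfold_locales
  let ?P = nbhd_program
  let ?l1 = "length (code main 1)" and ?l2 = "length (code print_coeffs (1 + length (code main 1)))"
  define S where "S = \<lparr>var = (\<lambda>_. 0), arr = (\<lambda>_ _. 0), source = encode_graph vs E, result = []\<rparr>"
  define S1 where "S1 = sem (Input rLim) S"
  define S2 where "S2 = sem main S1"
  define S3 where "S3 = sem print_coeffs S2"
  have P: "?P = code (Input rLim) 0 @ code main 1 @ code print_coeffs (1 + ?l1)"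
    by (simp add: nbhd_program_def Let_def)
  have placed: "sits ?P 0 (code (Input rLim) 0)" "sits ?P 1 (code main 1)"
    "sits ?P (1 + ?l1) (code print_coeffs (1 + ?l1))"
    unfolding sits_def P
    by (rule exI[of _ "[]"], simp) (rule exI[of _ "code (Input rLim) 0"], simp,
      rule exI[of _ "code (Input rLim) 0 @ code main 1"], simp)
  have S1: "var S1 = (\<lambda>_. 0)(rLim := n)" "arr S1 = (\<lambda>_ _. 0)" "result S1 = []"
    "source S1 = tl (encode_graph vs E)"
    by (simp_all add: S1_def S_def encode_graph_def)
  note main = main_correct[OF S1, folded S2_def]
  have D: "var S2 rLim \<le> n"
  proof -
    have "card {k. k < n \<and> nbhd_coeff E vs k \<noteq> 0} \<le> card {..<n}"
      by (intro card_mono) auto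
    then show ?thesis
      using main(2) by simp
  qed
  have "reaches ?P 0 S 1 1 S1"
    using code_correct[OF placed(1), of S] by (simp add: S1_def)
  moreover have "reaches ?P 1 S1 (steps main n) (1 + ?l1) S2"
    using code_correct[OF placed(2) well_formed_main, of S1] S1(1) by (simp add: S2_def)
  moreover have "reaches ?P (1 + ?l1) S2 (steps print_coeffs (var S2 rLim)) (1 + ?l1 + ?l2) S3"
    using code_correct[OF placed(3) well_formed_print_coeffs, of S2] by (simp add: S3_def)
  ultimately have "reaches ?P 0 S (1 + (steps main n + steps print_coeffs (var S2 rLim))) (1 + ?l1 + ?l2) S3"
    by (rule reaches_trans[OF _ reaches_trans])
  moreover have "represents \<lparr>pc = 0, mem = (\<lambda>_. 0), inp = encode_graph vs E, out = []\<rparr> S"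
    by (simp add: represents_def S_def)
  ultimately obtain s' where s': "stepn ?P (1 + (steps main n + steps print_coeffs (var S2 rLim)))
      \<lparr>pc = 0, mem = (\<lambda>_. 0), inp = encode_graph vs E, out = []\<rparr> s'"
      "represents s' S3" "pc s' = 1 + ?l1 + ?l2"
    unfolding reaches_def by (metis config.select_convs(1))
  have "out s' = result S3"
    using s'(2) by (simp add: represents_def)
  also have "\<dots> = map (arr S2 aP) [0..<var S2 rLim]"
    using print_coeffs[of S2] main(3) by (simp add: S3_def)
  also have "\<dots> = map (nbhd_coeff E vs) [0..<var S2 rLim]"
    using main(1) D by simp
  also have "\<dots> = coeffs (nbhd_poly V E)"
    using coeffs_nbhd_poly assms(2) main(2) by simp
  finally have "out s' = coeffs (nbhd_poly V E)" .
  moreover have "1 + (steps main n + steps print_coeffs (var S2 rLim)) \<le> program_steps n"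
    using steps_mono[OF D, of print_coeffs] by (simp add: program_steps_def)
  moreover have "length ?P \<le> pc s'"
    by (simp add: P s'(3))
  ultimately show ?thesis
    using s'(1) by blast
qed

lemma bounded_constants: "\<exists>C. \<forall>i c. Const i c \<in> set xs \<longrightarrow> c \<le> C"
proof (induction xs)
  case (Cons x xs)
  then obtain C where C: "\<forall>i c. Const i c \<in> set xs \<longrightarrow> c \<le> C"
    by blast
  define C' where "C' = C + (case x of Const i c \<Rightarrow> c | _ \<Rightarrow> 0)"
  have "c \<le> C'" if "Const i c \<in> set (x # xs)" for i c
    using that C by (auto simp: C'_def intro: trans_le_add1)
  then show ?case
    by blast
qed simp

theorem corollary14:
  shows "\<exists>(P :: instr list) (q :: nat poly).
    \<forall>(V :: nat set) (E :: nat set set) (vs :: nat list).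
      simple_graph V E \<and> planar V E \<and> distinct vs \<and> set vs = V \<longrightarrow>
      (\<exists>t. computes_in_time P (encode_graph vs E) (coeffs (nbhd_poly V E)) t \<and>
           t \<le> poly q (card V + card E))"
proof -
  obtain C where C: "\<forall>i c. Const i c \<in> set nbhd_program \<longrightarrow> c \<le> C"
    using bounded_constants by blast
  \<comment> \<open>The initial bound \<open>n + (C + 1)\<close> covers the vertex number, the
    matrix bits and all constants of the program, and it is positive. Its bit length is estimated by
    the number itself.\<close>
  define time where "time n = program_steps n * (2 * (program_steps n + (n + (C + 1))))" for n
  have "poly_bounded time"
    unfolding time_def program_steps_def by (intro poly_bounded_intros poly_bounded_steps)
  then obtain q :: "nat poly" where q: "\<And>n m. n \<le> m \<Longrightarrow> time n \<le> poly q m"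
    unfolding poly_bounded_def by blast
  show ?thesis
  proof (intro exI[of _ nbhd_program] exI[of _ q] allI impI)
    fix V :: "nat set" and E :: "nat set set" and vs :: "nat list"
    assume G: "simple_graph V E \<and> planar V E \<and> distinct vs \<and> set vs = V"
    let ?n = "length vs" and ?s = "\<lparr>pc = 0, mem = (\<lambda>_. 0), inp = encode_graph vs E, out = []\<rparr>"
    obtain k s' where k: "k \<le> program_steps ?n" "stepn nbhd_program k ?s s'"
      "length nbhd_program \<le> pc s'" "out s' = coeffs (nbhd_poly V E)"
      using nbhd_program_correct[of V E vs] G by blast
    let ?B = "?n + (C + 1)"
    have "\<forall>x\<in>set (inp ?s). x \<le> ?B"
      by (auto simp: encode_graph_def)
    moreover have "c \<le> ?B" if "Const i c \<in> set nbhd_program" for i c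
      using C that by (simp add: trans_le_add2 le_SucI)
    ultimately obtain t where t: "run nbhd_program ?s t s'" "t \<le> k * (2 * (k + bits ?B))"
      using run_of_stepn[OF k(2,3), of ?B] by auto
    have "k * (2 * (k + bits ?B)) \<le> time ?n"
      unfolding time_def using k(1) bits_le[of ?B] by (intro mult_le_mono add_le_mono) simp_all
    moreover have "time ?n \<le> poly q (card V + card E)"
      using G distinct_card[of vs] by (intro q) auto
    ultimately show "\<exists>t. computes_in_time nbhd_program (encode_graph vs E) (coeffs (nbhd_poly V E)) t \<and>
        t \<le> poly q (card V + card E)"
      using t k(4) unfolding computes_in_time_def by (meson le_trans)
  qed
qed

end
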